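(* There exists a randomized algorithm which, given a transformed special instance $(F,\alpha)$ of $(\nu(F)+k)$-SAT, decides whether $\mathrm{sat}(F)\ge\alpha$ in expected time $O\big(8^{k+O(\sqrt{k})}(m+n)^{O(1)}\big)$, where $k=\alpha-\nu(F)$, $n=|V(F)|$, $m=|F|$.
   Context: A CNF formula $F$ is a finite multiset of clauses; each clause is a nonempty set of literals (a variable $x$ or its negation $\bar x$) not containing both a variable and its negation. $V(F)$ is the set of variables, $V(c)$ the set of variables of clause $c$. A truth assignment satisfies a clause if some literal of it is true; $\mathrm{sat}(F)$ is the maximum number of clauses (with multiplicity) satisfied by a truth assignment. $B_F$ is the bipartite graph on $V(F)\cup F$ with $v$ adjacent to $c$ iff $v\in V(c)$, and $\nu(F)$ is the maximum matching size of $B_F$. $(\nu(F)+k)$-SAT: given $F$ and a positive integer $\alpha$, parameter $k=\alpha-\nu(F)$, decide whether $\mathrm{sat}(F)\ge\alpha$. For a variable $x$, $n(x)$ and $n(\bar x)$ denote the numbers of clauses containing the literal $x$ and $\bar x$ respectively. An instance $(F,\alpha)$ is a transformed special instance if: every clause contains at most one positive literal; for every variable $x$, $n(x)=1$ and $n(\bar x)\ge 2$; and for every variable $x$ the unique clause containing the literal $x$ is the unit clause $(x)$. *)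

theory Defs
  imports "HOL-Probability.SPMF" "HOL-Library.Multiset" "HOL-Library.Discrete_Functions"
begin

section \<open>CNF formulas\<close>

datatype 'v literal = Pos 'v | Neg 'v

primrec var :: "'v literal \<Rightarrow> 'v" where
  "var (Pos x) = x"
| "var (Neg x) = x"

type_synonym 'v clause = "'v literal set"
type_synonym 'v formula = "'v clause multiset"

definition is_cnf :: "'v formula \<Rightarrow> bool" where
  "is_cnf F \<longleftrightarrow>
     (\<forall>c \<in># F. finite c \<and> c \<noteq> {} \<and> \<not> (\<exists>x. Pos x \<in> c \<and> Neg x \<in> c))"

definition vars_clause :: "'v clause \<Rightarrow> 'v set" where
  "vars_clause c = var ` c"

definition vars :: "'v formula \<Rightarrow> 'v set" where
  "vars F = (\<Union>c \<in> set_mset F. vars_clause c)"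

primrec lit_true :: "('v \<Rightarrow> bool) \<Rightarrow> 'v literal \<Rightarrow> bool" where
  "lit_true \<tau> (Pos x) = \<tau> x"
| "lit_true \<tau> (Neg x) = (\<not> \<tau> x)"

definition satisfies :: "('v \<Rightarrow> bool) \<Rightarrow> 'v clause \<Rightarrow> bool" where
  "satisfies \<tau> c \<longleftrightarrow> (\<exists>l \<in> c. lit_true \<tau> l)"

definition sat :: "'v formula \<Rightarrow> nat" where
  "sat F = Max (range (\<lambda>\<tau>. size {#c \<in># F. satisfies \<tau> c#}))"

text \<open>
  The \<open>count F c\<close> copies of a clause \<open>c\<close> in the multiset \<open>F\<close> are distinct vertices
  \<open>Inr (c, i)\<close> of \<open>B\<^sub>F\<close>, one for each \<open>i < count F c\<close>.
\<close>

definition B_edges :: "'v formula \<Rightarrow> ('v + 'v clause \<times> nat) set set" where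
  "B_edges F = {{Inl v, Inr (c, i)} | v c i. i < count F c \<and> v \<in> vars_clause c}"

definition matching :: "'a set set \<Rightarrow> 'a set set \<Rightarrow> bool" where
  "matching E M \<longleftrightarrow> M \<subseteq> E \<and> pairwise disjnt M"

definition \<nu> :: "'v formula \<Rightarrow> nat" where
  "\<nu> F = Max (card ` {M. matching (B_edges F) M})"

definition occ :: "'v formula \<Rightarrow> 'v literal \<Rightarrow> nat" where
  "occ F l = size {#c \<in># F. l \<in> c#}"

definition transformed_special_instance :: "'v formula \<Rightarrow> nat \<Rightarrow> bool" where
  "transformed_special_instance F \<alpha> \<longleftrightarrow>
     is_cnf F \<and> \<alpha> > 0 \<and>
     (\<forall>c \<in># F. card {l \<in> c. \<exists>x. l = Pos x} \<le> 1) \<and>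
     (\<forall>x \<in> vars F. occ F (Pos x) = 1 \<and> occ F (Neg x) \<ge> 2) \<and>
     (\<forall>x \<in> vars F. \<forall>c \<in># F. Pos x \<in> c \<longrightarrow> c = {Pos x})"


section \<open>Randomized random access machines\<close>

text \<open>
  Algorithms are programs of a structured random access machine with addition, truncated
  subtraction and indirect addressing, extended by fair coin flips. The memory consists of
  arrays of natural numbers. Time is charged by the logarithmic cost criterion, since with
  unit costs unboundedly large numbers could be manipulated for free: every evaluation of a
  subexpression costs the bit length of its value, so operands and memory addresses are paid for.
\<close>

type_synonym store = "string \<Rightarrow> nat \<Rightarrow> nat"

datatype aexp =
    Num nat
  | Read string aexp
  | Plus aexp aexp
  | Minus aexp aexp

datatype com =
    Skip
  | Assign string aexp aexp   (* Assign a i e: the cell of a at address i becomes e *)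
  | Flip string aexp          (* Flip a i: the cell of a at address i becomes a random bit *)
  | Seq com com
  | If aexp com com           (* nonzero means true *)
  | While aexp com

definition bit_length :: "nat \<Rightarrow> nat" where
  "bit_length n = Suc (floor_log n)"

primrec aval :: "aexp \<Rightarrow> store \<Rightarrow> nat" where
  "aval (Num n) s = n"
| "aval (Read a i) s = s a (aval i s)"
| "aval (Plus e1 e2) s = aval e1 s + aval e2 s"
| "aval (Minus e1 e2) s = aval e1 s - aval e2 s"

primrec acost :: "aexp \<Rightarrow> store \<Rightarrow> nat" where
  "acost (Num n) s = bit_length n"
| "acost (Read a i) s = acost i s + bit_length (aval (Read a i) s)"
| "acost (Plus e1 e2) s = acost e1 s + acost e2 s + bit_length (aval (Plus e1 e2) s)"
| "acost (Minus e1 e2) s = acost e1 s + acost e2 s + bit_length (aval (Minus e1 e2) s)"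

definition update :: "store \<Rightarrow> string \<Rightarrow> nat \<Rightarrow> nat \<Rightarrow> store" where
  "update s a i v = s(a := (s a)(i := v))"

partial_function (spmf) while_spmf :: "('s \<Rightarrow> bool) \<Rightarrow> ('s \<Rightarrow> 's spmf) \<Rightarrow> 's \<Rightarrow> 's spmf" where
  "while_spmf b f s = (if b s then bind_spmf (f s) (while_spmf b f) else return_spmf s)"

text \<open>
  The second component of a configuration is the time spent so far. In a loop, each test of the
  guard, including the last one, is charged.
\<close>

type_synonym config = "store \<times> nat"

primrec exec :: "com \<Rightarrow> config \<Rightarrow> config spmf" where
  "exec Skip = (\<lambda>(s, t). return_spmf (s, t + 1))"
| "exec (Assign a i e) = (\<lambda>(s, t).
     return_spmf (update s a (aval i s) (aval e s), t + 1 + acost i s + acost e s))"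
| "exec (Flip a i) = (\<lambda>(s, t).
     map_spmf (\<lambda>b. (update s a (aval i s) (of_bool b), t + 1 + acost i s)) coin_spmf)"
| "exec (Seq c1 c2) = (\<lambda>cf. bind_spmf (exec c1 cf) (exec c2))"
| "exec (If e c1 c2) = (\<lambda>(s, t).
     (if aval e s \<noteq> 0 then exec c1 else exec c2) (s, t + 1 + acost e s))"
| "exec (While e c) = (\<lambda>cf.
     map_spmf (\<lambda>(s, t). (s, t + 1 + acost e s))
       (while_spmf (\<lambda>(s, t). aval e s \<noteq> 0) (\<lambda>(s, t). exec c (s, t + 1 + acost e s)) cf))"

definition init_store :: "nat list \<Rightarrow> store" where
  "init_store w = (\<lambda>a i. if a = ''in'' \<and> i < length w then w ! i else 0)"

definition run :: "com \<Rightarrow> nat list \<Rightarrow> config spmf" where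
  "run p w = exec p (init_store w, 0)"

text \<open>
  With probability 1 the program halts and its output, which is found in the first cell of the
  array \<open>out\<close>, is the truth value \<open>b\<close>.
\<close>

definition decides :: "com \<Rightarrow> nat list \<Rightarrow> bool \<Rightarrow> bool" where
  "decides p w b \<longleftrightarrow> map_spmf (\<lambda>(s, t). s ''out'' 0 \<noteq> 0) (run p w) = return_spmf b"

text \<open>The outcome \<open>None\<close> of a subprobability mass function stands for nontermination.\<close>

definition expected_time :: "com \<Rightarrow> nat list \<Rightarrow> ennreal" where
  "expected_time p w =
     (\<integral>\<^sup>+ r. (case r of None \<Rightarrow> \<infinity> | Some (s, t) \<Rightarrow> of_nat t) \<partial>measure_pmf (run p w))"


section \<open>Input encoding\<close>

text \<open>
  An instance is presented as \<open>\<alpha>\<close>, the number of variables and the number of clauses,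
  followed by the clauses in any order; each clause is given by its number of literals and its
  literals in any order. The variables are numbered arbitrarily by \<open>0, \<dots>, n - 1\<close>, so that all
  entries after \<open>\<alpha>\<close> are small.
\<close>

primrec enc_literal :: "('v \<Rightarrow> nat) \<Rightarrow> 'v literal \<Rightarrow> nat list" where
  "enc_literal f (Pos x) = [1, f x]"
| "enc_literal f (Neg x) = [0, f x]"

definition enc_clause :: "('v \<Rightarrow> nat) \<Rightarrow> 'v literal list \<Rightarrow> nat list" where
  "enc_clause f c = length c # concat (map (enc_literal f) c)"

definition encodes :: "nat list \<Rightarrow> 'v formula \<Rightarrow> nat \<Rightarrow> bool" where
  "encodes w F \<alpha> \<longleftrightarrow>
     (\<exists>f cs. bij_betw f (vars F) {..<card (vars F)} \<and>
        (\<forall>c \<in> set cs. distinct c) \<and> mset (map set cs) = F \<and>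
        w = \<alpha> # card (vars F) # size F # concat (map (enc_clause f) cs))"

end

theory Submission
  imports Defs
begin

text \<open>
  Since every variable has its own positive unit clause and all other clauses are negative,
  \<open>\<nu> F \<le> n\<close>, and \<open>sat F \<ge> n + k\<close> means that some set \<open>S\<close> of variables, those set to false, hits at
  least \<open>card S + k\<close> negative clauses. Greedily collect variables that hit at least two new clauses.
  If the \<open>s\<close> collected variables hit \<open>h \<ge> s + k\<close> clauses, the answer is yes. Otherwise \<open>2 * s \<le> h\<close>
  yields \<open>h < 2 * k\<close>, and every variable lies in at most one of the remaining clauses. Hence
  dynamic programming over the subsets of the \<open>h\<close> clauses, with the variables grouped by their
  remaining clause, decides the instance without coin flips in time \<open>4 ^ k * (m + n) ^ O(1)\<close>,
  where \<open>k = \<alpha> - n \<le> \<alpha> - \<nu> F\<close>.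
\<close>

section \<open>Deterministic programs\<close>

text \<open>A variable set to false gives up its own unit clause and gains the negative clauses that
  contain it; hence the value of \<open>S\<close> is hits minus \<open>card S\<close>, measured
  against n. The threshold of two new clauses does double duty: each collected variable gains at
  least one clause more than it costs, so \<open>h < s + k\<close> and \<open>2 * s \<le> h\<close>
  force \<open>h < 2 * k\<close>; and each variable is left with at most one unmarked clause. An
  unmarked clause thus concerns only the variables of one group, and a single extra bit records
  whether it is still to be hit while that group is processed. The strictness of
  \<open>h < 2 * k\<close> pays for this bit: the table has \<open>2 ^ (h + 1) \<le> 4 ^ k\<close>
  entries. The logarithmic cost criterion shapes the rest. Addresses of the table have about h bits,
  so the charge is a polynomial factor once all values are known to stay below a fixed
  \<open>2 ^ b\<close>; every program specification therefore carries \<open>b\<close> besides its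
  operation count. Only \<alpha> can be huge compared with the formula, and the case \<alpha> > m is
  settled before the main computation.\<close>

abbreviation V :: "string \<Rightarrow> aexp" where
  "V a \<equiv> Read a (Num 0)"

abbreviation assign :: "string \<Rightarrow> aexp \<Rightarrow> com" (infix "::=" 65) where
  "a ::= e \<equiv> Assign a (Num 0) e"

abbreviation seq :: "com \<Rightarrow> com \<Rightarrow> com" (infixr ";;" 60) where
  "c1 ;; c2 \<equiv> Seq c1 c2"

text \<open>Under truncated subtraction one summand vanishes, so the sum is the absolute difference;
  as a guard it tests for inequality.\<close>

definition Diff :: "aexp \<Rightarrow> aexp \<Rightarrow> aexp" where
  "Diff e1 e2 = Plus (Minus e1 e2) (Minus e2 e1)"

definition For :: "string \<Rightarrow> aexp \<Rightarrow> com \<Rightarrow> com" where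
  "For x e c =
     Seq (Assign x (Num 0) (Num 0))
       (While (Minus e (V x)) (Seq c (Assign x (Num 0) (Plus (V x) (Num 1)))))"

text \<open>Bounds every intermediate value of an evaluation, because each of them is charged its
  bit length. \<open>Minus\<close> adds no bound of its own: the result never exceeds the first
  operand.\<close>

primrec fits :: "nat \<Rightarrow> aexp \<Rightarrow> store \<Rightarrow> bool" where
  "fits B (Num n) s \<longleftrightarrow> n < B"
| "fits B (Read a i) s \<longleftrightarrow> fits B i s \<and> s a (aval i s) < B"
| "fits B (Plus e1 e2) s \<longleftrightarrow> fits B e1 s \<and> fits B e2 s \<and> aval e1 s + aval e2 s < B"
| "fits B (Minus e1 e2) s \<longleftrightarrow> fits B e1 s \<and> fits B e2 s"

primrec nodes :: "aexp \<Rightarrow> nat" where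
  "nodes (Num n) = 1"
| "nodes (Read a i) = nodes i + 1"
| "nodes (Plus e1 e2) = nodes e1 + nodes e2 + 1"
| "nodes (Minus e1 e2) = nodes e1 + nodes e2 + 1"

primrec reads :: "aexp \<Rightarrow> string set" where
  "reads (Num n) = {}"
| "reads (Read a i) = insert a (reads i)"
| "reads (Plus e1 e2) = reads e1 \<union> reads e2"
| "reads (Minus e1 e2) = reads e1 \<union> reads e2"

primrec writes :: "com \<Rightarrow> string set" where
  "writes Skip = {}"
| "writes (Assign a i e) = {a}"
| "writes (Flip a i) = {a}"
| "writes (Seq c1 c2) = writes c1 \<union> writes c2"
| "writes (If e c1 c2) = writes c1 \<union> writes c2"
| "writes (While e c) = writes c"

lemma writes_For [simp]: "writes (For x e c) = insert x (writes c)"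
  by (simp add: For_def insert_commute)

lemma fits_aval: "fits B e s \<Longrightarrow> aval e s < B"
  by (induction e) auto

lemma aval_cong: "(\<And>a. a \<in> reads e \<Longrightarrow> s a = s' a) \<Longrightarrow> aval e s = aval e s'"
  by (induction e) auto

lemma fits_cong: "(\<And>a. a \<in> reads e \<Longrightarrow> s a = s' a) \<Longrightarrow> fits B e s = fits B e s'"
proof (induction e)
  case (Read a i)
  then have "aval i s = aval i s'" by (intro aval_cong) auto
  with Read show ?case by auto
next
  case (Plus e1 e2)
  then have "aval e1 s = aval e1 s'" "aval e2 s = aval e2 s'" by (auto intro: aval_cong)
  with Plus show ?case by auto
qed auto

lemma aval_Diff [simp]: "aval (Diff e1 e2) s = 0 \<longleftrightarrow> aval e1 s = aval e2 s"
  by (auto simp: Diff_def)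

lemma fits_Diff [simp]: "fits B (Diff e1 e2) s \<longleftrightarrow> fits B e1 s \<and> fits B e2 s"
  using fits_aval[of B e1 s] fits_aval[of B e2 s] by (auto simp: Diff_def)

lemma nodes_Diff [simp]: "nodes (Diff e1 e2) = 2 * nodes e1 + 2 * nodes e2 + 3"
  by (simp add: Diff_def)

lemma reads_Diff [simp]: "reads (Diff e1 e2) = reads e1 \<union> reads e2"
  by (auto simp: Diff_def)

lemma bit_length_le: "x < 2 ^ b \<Longrightarrow> b > 0 \<Longrightarrow> bit_length x \<le> b"
proof -
  assume x: "x < 2 ^ b" "b > 0"
  show ?thesis
  proof (cases "x = 0")
    case False
    then have "(2::nat) ^ floor_log x < 2 ^ b"
      using x(1) floor_log_exp2_le[of x] by linarith
    then show ?thesis by (simp add: bit_length_def)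
  qed (use x in \<open>simp add: bit_length_def\<close>)
qed

text \<open>An opaque name for the power, so that size conditions treat the bound as an atom of
  linear arithmetic.\<close>

definition wbound :: "nat \<Rightarrow> nat" where
  "wbound b = 2 ^ b"

lemma acost_le:
  assumes "b > 0" "fits (wbound b) e s"
  shows "acost e s \<le> nodes e * b"
  using assms(2)
proof (induction e)
  case (Minus e1 e2)
  then have "aval (Minus e1 e2) s < wbound b" using fits_aval by blast
  then have "bit_length (aval (Minus e1 e2) s) \<le> b" using bit_length_le assms(1) by (auto simp: wbound_def)
  with Minus show ?case by (simp add: algebra_simps)
qed (use bit_length_le[OF _ assms(1)] in \<open>fastforce simp: algebra_simps wbound_def\<close>)+

section \<open>Program logic with operation counts and frame conditions\<close>

text \<open>
  The bound \<open>N\<close> counts operations. All values being smaller than \<open>2 ^ b\<close>, each of them costs at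
  most \<open>b\<close>.
\<close>

definition runs :: "nat \<Rightarrow> com \<Rightarrow> store \<Rightarrow> nat \<Rightarrow> (store \<Rightarrow> bool) \<Rightarrow> bool" where
  "runs b c s N Q \<longleftrightarrow> b > 0 \<and>
     (\<exists>s' t. (\<forall>t0. exec c (s, t0) = return_spmf (s', t0 + t)) \<and> t \<le> N * b \<and> Q s' \<and>
        (\<forall>a. a \<notin> writes c \<longrightarrow> s' a = s a))"

lemma runs_conseq:
  assumes "runs b c s N Q" "N \<le> N'"
    and "\<And>s'. Q s' \<Longrightarrow> \<forall>a. a \<notin> writes c \<longrightarrow> s' a = s a \<Longrightarrow> Q' s'"
  shows "runs b c s N' Q'"
proof -
  have "N * b \<le> N' * b" using assms(2) by simp
  then show ?thesis using assms unfolding runs_def by (meson order_trans)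
qed

lemma runs_Assign:
  assumes "b > 0" "fits (wbound b) i s" "fits (wbound b) e s" "Q (update s a (aval i s) (aval e s))"
  shows "runs b (Assign a i e) s (nodes i + nodes e + 1) Q"
proof -
  have "1 + acost i s + acost e s \<le> (nodes i + nodes e + 1) * b"
    using acost_le[OF assms(1,2)] acost_le[OF assms(1,3)] assms(1) by (simp add: algebra_simps)
  then show ?thesis using assms unfolding runs_def
    by (intro conjI exI[of _ "update s a (aval i s) (aval e s)"] exI[of _ "1 + acost i s + acost e s"])
       (auto simp: update_def)
qed

lemma runs_Seq:
  assumes "runs b c1 s N1 P"
    and "\<And>s'. P s' \<Longrightarrow> \<forall>a. a \<notin> writes c1 \<longrightarrow> s' a = s a \<Longrightarrow> runs b c2 s' N2 Q"
  shows "runs b (Seq c1 c2) s (N1 + N2) Q"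
proof -
  from assms(1) obtain s1 t1 where 1: "b > 0" "\<forall>t0. exec c1 (s, t0) = return_spmf (s1, t0 + t1)"
      "t1 \<le> N1 * b" "P s1" "\<forall>a. a \<notin> writes c1 \<longrightarrow> s1 a = s a"
    unfolding runs_def by blast
  from assms(2)[OF 1(4,5)] obtain s2 t2
    where 2: "\<forall>t0. exec c2 (s1, t0) = return_spmf (s2, t0 + t2)"
      "t2 \<le> N2 * b" "Q s2" "\<forall>a. a \<notin> writes c2 \<longrightarrow> s2 a = s1 a"
    unfolding runs_def by blast
  show ?thesis unfolding runs_def
    using 1 2 by (intro conjI exI[of _ s2] exI[of _ "t1 + t2"]) (auto simp: algebra_simps)
qed

lemma runs_If:
  assumes "b > 0" "fits (wbound b) e s"
    and "aval e s \<noteq> 0 \<Longrightarrow> runs b c1 s N Q" "aval e s = 0 \<Longrightarrow> runs b c2 s N Q"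
  shows "runs b (If e c1 c2) s (nodes e + 1 + N) Q"
proof -
  have "runs b (if aval e s \<noteq> 0 then c1 else c2) s N Q" using assms(3,4) by simp
  then obtain s' t where t: "\<forall>t0. exec (if aval e s \<noteq> 0 then c1 else c2) (s, t0) = return_spmf (s', t0 + t)"
      "t \<le> N * b" "Q s'" "\<forall>a. a \<notin> writes (if aval e s \<noteq> 0 then c1 else c2) \<longrightarrow> s' a = s a"
    unfolding runs_def by blast
  have "1 + acost e s + t \<le> (nodes e + 1 + N) * b"
    using acost_le[OF assms(1,2)] assms(1) t(2) by (simp add: algebra_simps)
  then show ?thesis using assms(1) t unfolding runs_def
    by (intro conjI exI[of _ s'] exI[of _ "1 + acost e s + t"])
       (auto simp: add.assoc[symmetric] split: if_splits)
qed

text \<open>The map that charges the final guard test stands outside the fixpoint; pushing it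
  through the bind turns the rest of the loop back into an execution of
  \<open>While e c\<close>.\<close>

lemma exec_While:
  "exec (While e c) (s, t) =
     (if aval e s \<noteq> 0 then bind_spmf (exec c (s, t + 1 + acost e s)) (exec (While e c))
      else return_spmf (s, t + 1 + acost e s))"
  by (simp add: while_spmf.simps[of _ _ "(s, t)"] map_spmf_bind_spmf o_def)

lemma runs_While_end:
  assumes "b > 0" "fits (wbound b) e s" "aval e s = 0" "Q s"
  shows "runs b (While e c) s (nodes e + 1) Q"
proof -
  have "1 + acost e s \<le> (nodes e + 1) * b"
    using acost_le[OF assms(1,2)] assms(1) by (simp add: algebra_simps)
  then show ?thesis using assms unfolding runs_def
    by (intro conjI exI[of _ s] exI[of _ "1 + acost e s"]) (auto simp: exec_While simp del: exec.simps)
qed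

lemma runs_While_step:
  assumes "fits (wbound b) e s" "aval e s \<noteq> 0" "runs b (Seq c (While e c)) s N Q"
  shows "runs b (While e c) s (nodes e + 1 + N) Q"
proof -
  from assms(3) obtain s' t where t: "b > 0"
      "\<forall>t0. exec (Seq c (While e c)) (s, t0) = return_spmf (s', t0 + t)"
      "t \<le> N * b" "Q s'" "\<forall>a. a \<notin> writes (While e c) \<longrightarrow> s' a = s a"
    unfolding runs_def by (auto simp del: exec.simps)
  have "1 + acost e s + t \<le> (nodes e + 1 + N) * b"
    using acost_le[OF t(1) assms(1)] t(1,3) by (simp add: algebra_simps)
  moreover have "exec (While e c) (s, t0) = return_spmf (s', t0 + (1 + acost e s + t))" for t0
    using t(2)[rule_format, of "t0 + 1 + acost e s"] assms(2)
    unfolding exec_While by (simp add: add.assoc del: exec.simps(6))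
  ultimately show ?thesis using t unfolding runs_def by blast
qed

text \<open>All loops of the algorithm are counting loops, so this rule supplies every termination
  argument. The invariant describes the store after the counter has been advanced, hence the
  \<open>update\<close> in the premise on the body. Facts about arrays outside the loop's writes
  reach the body through the comparison with \<open>s0\<close> instead of through
  \<open>I\<close>.\<close>

lemma runs_For:
  assumes "b > 0" "x \<notin> writes c" "reads e \<inter> insert x (writes c) = {}"
    and e: "fits (wbound b) e s0" "aval e s0 = N"
    and I0: "I 0 (update s0 x 0 0)"
    and step: "\<And>i s. i < N \<Longrightarrow> I i s \<Longrightarrow> s x 0 = i \<Longrightarrow>
      \<forall>a. a \<notin> insert x (writes c) \<longrightarrow> s a = s0 a \<Longrightarrow>
      runs b c s T (\<lambda>s'. I (Suc i) (update s' x 0 (Suc i)))"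
  shows "runs b (For x e c) s0 ((N + 1) * (T + nodes e + 13)) (I N)"
proof -
  let ?g = "Minus e (V x)" and ?inc = "Assign x (Num 0) (Plus (V x) (Num 1))"
  let ?fr = "\<lambda>s. \<forall>a. a \<notin> insert x (writes c) \<longrightarrow> s a = s0 a"
  have NB: "N < wbound b" using fits_aval[OF e(1)] e(2) by simp
  have B1: "1 < wbound b" using \<open>b > 0\<close> unfolding wbound_def by (intro one_less_power) auto
  have eval: "aval e s = N" "fits (wbound b) e s" if "?fr s" for s
  proof -
    have *: "s a = s0 a" if "a \<in> reads e" for a using that assms(3) \<open>?fr s\<close> by blast
    show "aval e s = N" using aval_cong[of e s s0] * e(2) by auto
    show "fits (wbound b) e s" using fits_cong[of e s s0] * e(1) by auto
  qed
  \<comment> \<open>The guard has \<open>nodes e + 3\<close> nodes and a charge of 1, the increment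
    costs 6: together 10 beyond \<open>T\<close>. The factor includes the final test, and the cost 3
    of initialising the counter later raises 10 to 13.\<close>
  have loop: "runs b (While ?g (Seq c ?inc)) s ((N - i + 1) * (T + nodes e + 10)) (I N)"
    if "i \<le> N" "I i s" "s x 0 = i" "?fr s" for i s
    using that
  proof (induction "N - i" arbitrary: i s)
    case 0
    then have "i = N" by simp
    with 0 show ?case
      by (intro runs_conseq[OF runs_While_end]) (use eval[of s] NB \<open>b > 0\<close> in auto)
  next
    case (Suc d)
    have iN: "i < N" using Suc by simp
    have body: "runs b (Seq c ?inc) s (T + 6) (\<lambda>s'. I (Suc i) s' \<and> s' x 0 = Suc i)"
    proof (rule runs_conseq[OF runs_Seq[OF step[OF iN Suc(4,5,6)]]])
      fix s' assume s': "I (Suc i) (update s' x 0 (Suc i))" "\<forall>a. a \<notin> writes c \<longrightarrow> s' a = s a"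
      then have "s' x 0 = i" using assms(2) Suc by auto
      then show "runs b ?inc s' 6 (\<lambda>s'. I (Suc i) s' \<and> s' x 0 = Suc i)"
        using s' iN NB B1 \<open>b > 0\<close> by (intro runs_conseq[OF runs_Assign]) (auto simp: update_def)
    qed auto
    have "runs b (Seq (Seq c ?inc) (While ?g (Seq c ?inc))) s
        (T + 6 + (N - Suc i + 1) * (T + nodes e + 10)) (I N)"
    proof (rule runs_Seq[OF body])
      fix s' assume "I (Suc i) s' \<and> s' x 0 = Suc i" "\<forall>a. a \<notin> writes (Seq c ?inc) \<longrightarrow> s' a = s a"
      then show "runs b (While ?g (Seq c ?inc)) s' ((N - Suc i + 1) * (T + nodes e + 10)) (I N)"
        using Suc(6) iN Suc(2) by (intro Suc(1)) auto
    qed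
    from runs_While_step[OF _ _ this]
    have "runs b (While ?g (Seq c ?inc)) s
        (nodes ?g + 1 + (T + 6 + (N - Suc i + 1) * (T + nodes e + 10))) (I N)"
      using Suc eval[of s] iN NB B1 by auto
    moreover have "N - i + 1 = Suc (N - Suc i + 1)" using iN by simp
    ultimately show ?case by (elim runs_conseq) auto
  qed
  show ?thesis unfolding For_def
  proof (rule runs_conseq[OF runs_Seq[OF runs_Assign[where Q = "\<lambda>s. s = update s0 x 0 0"]]])
    fix s' assume "s' = update s0 x 0 0"
    then show "runs b (While ?g (Seq c ?inc)) s' ((N - 0 + 1) * (T + nodes e + 10)) (I N)"
      by (intro loop) (use I0 in \<open>auto simp: update_def\<close>)
  qed (use \<open>b > 0\<close> B1 in \<open>auto simp: algebra_simps\<close>)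
qed

section \<open>Weakest preconditions for straight-line code\<close>

text \<open>Only for code without loops and coin flips, so that the simplifier can evaluate it.\<close>

primrec wp :: "nat \<Rightarrow> com \<Rightarrow> (store \<Rightarrow> bool) \<Rightarrow> store \<Rightarrow> bool" where
  "wp B Skip Q s \<longleftrightarrow> Q s"
| "wp B (Assign a i e) Q s \<longleftrightarrow>
     fits B i s \<and> fits B e s \<and> Q (update s a (aval i s) (aval e s))"
| "wp B (Flip a i) Q s \<longleftrightarrow> False"
| "wp B (Seq c1 c2) Q s \<longleftrightarrow> wp B c1 (wp B c2 Q) s"
| "wp B (If e c1 c2) Q s \<longleftrightarrow>
     fits B e s \<and> (if aval e s \<noteq> 0 then wp B c1 Q s else wp B c2 Q s)"
| "wp B (While e c) Q s \<longleftrightarrow> False"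

text \<open>An upper bound: the sum over both branches dominates either one. The value 0 for loops
  and flips is sound in \<open>runs_wp_steps\<close> because \<open>wp\<close> is false on
  them.\<close>

primrec steps :: "com \<Rightarrow> nat" where
  "steps Skip = 1"
| "steps (Assign a i e) = nodes i + nodes e + 1"
| "steps (Flip a i) = 0"
| "steps (Seq c1 c2) = steps c1 + steps c2"
| "steps (If e c1 c2) = nodes e + 1 + (steps c1 + steps c2)"
| "steps (While e c) = 0"

lemma runs_wp_steps:
  assumes "b > 0" "wp (wbound b) c Q s"
  shows "runs b c s (steps c) Q"
  using assms(2)
proof (induction c arbitrary: s Q)
  case Skip
  then show ?case using assms(1) unfolding runs_def by (auto intro!: exI[of _ s] exI[of _ 1])
next
  case (Assign a i e)
  then show ?case using runs_Assign[OF assms(1)] by simp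
next
  case (Seq c1 c2)
  from Seq.prems have "wp (wbound b) c1 (wp (wbound b) c2 Q) s" by simp
  then show ?case using runs_Seq[OF Seq.IH(1)] Seq.IH(2) by fastforce
next
  case (If e c1 c2)
  then show ?case unfolding steps.simps
    by (intro runs_If[OF assms(1)])
       (auto intro!: runs_conseq[OF If.IH(1)] runs_conseq[OF If.IH(2)])
qed auto

lemma runs_wp: "b > 0 \<Longrightarrow> steps c \<le> T \<Longrightarrow> wp (wbound b) c Q s \<Longrightarrow> runs b c s T Q"
  by (rule runs_conseq[OF runs_wp_steps])

section \<open>Hitting more sets than elements spent\<close>

text \<open>
  The value of \<open>S\<close> is \<open>card (X \<inter> \<Union>(N ` S)) - card S\<close>; truncation at \<open>0\<close> does not
  change the maximum because \<open>S = {}\<close> has value \<open>0\<close>.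
\<close>

definition opt :: "('v \<Rightarrow> 'c set) \<Rightarrow> 'v set \<Rightarrow> 'c set \<Rightarrow> nat" where
  "opt N W X = Max ((\<lambda>S. card (X \<inter> \<Union>(N ` S)) - card S) ` Pow W)"

lemma opt_ge: "finite W \<Longrightarrow> S \<subseteq> W \<Longrightarrow> card (X \<inter> \<Union>(N ` S)) - card S \<le> opt N W X"
  unfolding opt_def by (rule Max_ge) auto

text \<open>Yields a maximiser on which the subtraction is exact. If it truncates at the one found,
  the maximum is 0 and the empty set attains it as well.\<close>

lemma opt_attained:
  assumes "finite W"
  obtains S where "S \<subseteq> W" "opt N W X = card (X \<inter> \<Union>(N ` S)) - card S"
    "card S \<le> card (X \<inter> \<Union>(N ` S))"
proof -
  have "opt N W X \<in> (\<lambda>S. card (X \<inter> \<Union>(N ` S)) - card S) ` Pow W"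
    unfolding opt_def using assms by (intro Max_in) auto
  then obtain S where S: "S \<subseteq> W" "opt N W X = card (X \<inter> \<Union>(N ` S)) - card S" by auto
  show thesis
  proof (cases "card S \<le> card (X \<inter> \<Union>(N ` S))")
    case False
    then show thesis using S by (intro that[of "{}"]) auto
  qed (use that S in blast)
qed

lemma opt_le_card: "finite W \<Longrightarrow> finite X \<Longrightarrow> opt N W X \<le> card X"
  by (rule opt_attained[of W N X]) (auto intro!: le_trans[OF diff_le_self] card_mono)

text \<open>Sets that no element of \<open>W\<close> can hit contribute to no value. This allows a
  table entry to be reinterpreted when the current group changes.\<close>

lemma opt_cong: "X \<inter> \<Union>(N ` W) = Y \<inter> \<Union>(N ` W) \<Longrightarrow> opt N W X = opt N W Y"
proof -
  assume *: "X \<inter> \<Union>(N ` W) = Y \<inter> \<Union>(N ` W)"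
  have "X \<inter> \<Union>(N ` S) = Y \<inter> \<Union>(N ` S)" if "S \<subseteq> W" for S
    using * that by blast
  then show ?thesis unfolding opt_def by (intro arg_cong[where f = Max] image_cong) auto
qed

lemma opt_empty [simp]: "opt N {} X = 0"
  by (simp add: opt_def)

text \<open>Branch on whether \<open>v\<close> is chosen: choosing it costs 1, hits
  \<open>X \<inter> N v\<close> and leaves \<open>X - N v\<close> to the other elements. Since 1 is
  subtracted last, truncation occurs only if both other terms are 0, and then the maximum absorbs
  it.\<close>

lemma opt_insert:
  assumes "finite W" "v \<notin> W" "finite X"
  shows "opt N (insert v W) X = max (opt N W X) (opt N W (X - N v) + card (X \<inter> N v) - 1)"
proof (rule antisym)
  have split: "card (X \<inter> \<Union>(N ` insert v S)) = card ((X - N v) \<inter> \<Union>(N ` S)) + card (X \<inter> N v)" for S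
  proof -
    have "X \<inter> \<Union>(N ` insert v S) = ((X - N v) \<inter> \<Union>(N ` S)) \<union> (X \<inter> N v)" by auto
    then show ?thesis using assms(3) by (simp add: card_Un_disjoint disjoint_iff)
  qed
  show "opt N (insert v W) X \<le> max (opt N W X) (opt N W (X - N v) + card (X \<inter> N v) - 1)"
  proof -
    obtain S where S: "S \<subseteq> insert v W" "opt N (insert v W) X = card (X \<inter> \<Union>(N ` S)) - card S"
      using opt_attained[of "insert v W"] assms(1) by (metis finite_insert)
    show ?thesis
    proof (cases "v \<in> S")
      case False
      then have "S \<subseteq> W" using S(1) by blast
      then show ?thesis using S(2) opt_ge[OF assms(1), of S X N] by simp
    next
      case True
      define T where "T = S - {v}"
      have T: "S = insert v T" "v \<notin> T" "T \<subseteq> W" using S True by (auto simp: T_def)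
      have "finite T" using T(3) assms(1) by (rule finite_subset)
      then show ?thesis using S(2) split[of T] T opt_ge[OF assms(1) T(3), of "X - N v" N] by auto
    qed
  qed
  have "opt N W (X - N v) + card (X \<inter> N v) - 1 \<le> opt N (insert v W) X"
  proof -
    obtain T where T: "T \<subseteq> W" "opt N W (X - N v) = card ((X - N v) \<inter> \<Union>(N ` T)) - card T"
        "card T \<le> card ((X - N v) \<inter> \<Union>(N ` T))"
      using opt_attained[OF assms(1)] by metis
    then have "finite T" "v \<notin> T" using assms(1,2) by (auto intro: finite_subset)
    then show ?thesis using opt_ge[of "insert v W" "insert v T" X N] assms(1) T split[of T] by auto
  qed
  moreover have "opt N W X \<le> opt N (insert v W) X"
    unfolding opt_def using assms(1) by (intro Max_mono) auto
  ultimately show "max (opt N W X) (opt N W (X - N v) + card (X \<inter> N v) - 1) \<le> opt N (insert v W) X"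
    by simp
qed

text \<open>
  A numbering \<open>g\<close> sends the \<open>h\<close> marked sets to \<open>1, \<dots>, h\<close> and all others to \<open>0\<close>. If each element
  lies in at most one unmarked set, then the elements can be grouped by it (\<open>slot\<close>, with \<open>0\<close> for
  elements all of whose sets are marked), and while the elements of one group are processed, only
  the marked sets and the unmarked set of this group have to be remembered. A state is a subset
  \<open>A\<close> of \<open>{..h}\<close>, where \<open>0\<close> stands for the unmarked set of the current group \<open>e\<close>; the unmarked
  sets of earlier groups are always to be hit, those of later groups never.
\<close>

locale numbering =
  fixes m n h :: nat and N :: "nat \<Rightarrow> nat set" and g :: "nat \<Rightarrow> nat"
  assumes N_sub: "\<And>v. N v \<subseteq> {..<m}"
    and g_bij: "bij_betw g {c. g c \<noteq> 0} {1..h}"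
    and unmarked_le1: "\<And>v. v < n \<Longrightarrow> card {c \<in> N v. g c = 0} \<le> 1"
begin

text \<open>For \<open>v < n\<close> the sum has at most one term, so it names the unmarked set
  without a choice operator and is 0 if there is none. \<open>Suc\<close> keeps set number 0 apart
  from that case.\<close>

definition slot :: "nat \<Rightarrow> nat" where
  "slot v = (\<Sum>c\<in>{c \<in> N v. g c = 0}. Suc c)"

definition state :: "nat \<Rightarrow> nat set \<Rightarrow> nat set" where
  "state e A = {c. c < m \<and> (if g c \<noteq> 0 then g c \<in> A else Suc c < e \<or> Suc c = e \<and> 0 \<in> A)}"

text \<open>An initial segment in the lexicographic order by slot and number, the order in which the
  two nested loops process the elements.\<close>

definition before :: "nat \<Rightarrow> nat \<Rightarrow> nat set" where
  "before e v = {u. u < n \<and> slot u < e} \<union> {u. u < v \<and> u < n \<and> slot u = e}"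

lemma finite_N [simp]: "finite (N v)"
  by (rule finite_subset[OF N_sub]) simp

lemma finite_state [simp]: "finite (state e A)"
  unfolding state_def by (rule finite_subset[of _ "{..<m}"]) auto

lemma card_state: "card (state e A) \<le> m"
proof -
  have "state e A \<subseteq> {..<m}" by (auto simp: state_def)
  then show ?thesis using card_mono[of "{..<m}" "state e A"] by simp
qed

lemma finite_before [simp]: "finite (before e v)"
  unfolding before_def by (rule finite_subset[of _ "{..<n}"]) auto

lemma g_le: "g c \<le> h"
  using g_bij by (cases "g c = 0") (auto simp: bij_betw_def)

lemma g_inj: "g c = g c' \<Longrightarrow> g c \<noteq> 0 \<Longrightarrow> c = c'"
  using g_bij by (auto simp: bij_betw_def inj_on_def)

lemma slot_eq: "v < n \<Longrightarrow> c \<in> N v \<Longrightarrow> g c = 0 \<Longrightarrow> slot v = Suc c"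
proof -
  assume *: "v < n" "c \<in> N v" "g c = 0"
  then have "{c \<in> N v. g c = 0} = {c}"
    using unmarked_le1[of v] by (auto simp: card_le_Suc0_iff_eq)
  then show ?thesis by (simp add: slot_def)
qed

lemma slot_zero: "{c \<in> N v. g c = 0} = {} \<Longrightarrow> slot v = 0"
  by (simp only: slot_def) simp

lemma slot_le: "v < n \<Longrightarrow> slot v \<le> m"
proof (cases "{c \<in> N v. g c = 0} = {}")
  case False
  then obtain c where c: "c \<in> N v" "g c = 0" by blast
  moreover assume "v < n"
  ultimately show ?thesis using slot_eq[of v c] N_sub[of v] by auto
qed (simp add: slot_zero)

text \<open>The number 0 is in the image of \<open>N v\<close> under \<open>g\<close> exactly when
  \<open>v\<close> lies in an unmarked set, which is then the one of group \<open>e\<close>; no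
  unmarked set of an earlier group contains \<open>v\<close>. So deleting sets from a state means
  deleting numbers from its code.\<close>

lemma state_diff:
  assumes "v < n" "slot v = e"
  shows "state e A - N v = state e (A - g ` N v)"
proof (rule set_eqI)
  fix c
  have "c \<in> N v \<longleftrightarrow> g c \<in> g ` N v" if "g c \<noteq> 0 \<or> Suc c = e"
  proof
    assume "g c \<in> g ` N v"
    then obtain c' where c': "c' \<in> N v" "g c = g c'" by auto
    show "c \<in> N v"
    proof (cases "g c = 0")
      case True
      then show ?thesis using slot_eq[of v c'] c' assms that by simp
    next
      case False
      then show ?thesis using g_inj[of c c'] c' by simp
    qed
  qed simp
  moreover have "c \<notin> N v" if "g c = 0" "Suc c < e"
    using that slot_eq[of v c] assms by auto
  ultimately show "c \<in> state e A - N v \<longleftrightarrow> c \<in> state e (A - g ` N v)"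
    by (cases "g c = 0") (auto simp: state_def)
qed

text \<open>\<open>g\<close> is injective on \<open>N v\<close>: marked sets have distinct numbers,
  and at most one set containing \<open>v\<close> has number 0.\<close>

lemma card_state_Int:
  assumes "v < n" "slot v = e"
  shows "card (state e A \<inter> N v) = card (A \<inter> g ` N v)"
proof (rule bij_betw_same_card[of g])
  show "bij_betw g (state e A \<inter> N v) (A \<inter> g ` N v)"
    unfolding bij_betw_def
  proof
    show "inj_on g (state e A \<inter> N v)"
    proof (rule inj_onI)
      fix c c' assume c: "c \<in> state e A \<inter> N v" "c' \<in> state e A \<inter> N v" "g c = g c'"
      show "c = c'"
      proof (cases "g c = 0")
        case True
        then show ?thesis using slot_eq[of v c] slot_eq[of v c'] c assms(1) by simp
      next
        case False
        then show ?thesis using g_inj c(3) by blast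
      qed
    qed
    show "g ` (state e A \<inter> N v) = A \<inter> g ` N v"
    proof (intro equalityI subsetI)
      fix i assume "i \<in> g ` (state e A \<inter> N v)"
      then obtain c where c: "c \<in> state e A" "c \<in> N v" "i = g c" by blast
      then show "i \<in> A \<inter> g ` N v"
        using slot_eq[of v c] assms by (cases "g c = 0") (auto simp: state_def)
    next
      fix i assume "i \<in> A \<inter> g ` N v"
      then obtain c where c: "g c \<in> A" "c \<in> N v" "i = g c" by blast
      then have "c \<in> state e A"
        using slot_eq[of v c] assms N_sub[of v] by (cases "g c = 0") (auto simp: state_def)
      then show "i \<in> g ` (state e A \<inter> N v)" using c by blast
    qed
  qed
qed

text \<open>The recursion \<open>opt_insert\<close> carried over to codes. Both values on the right
  are indexed by subsets of \<open>A\<close> and refer to the same group and position, so they are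
  entries of a single table.\<close>

lemma opt_step:
  assumes "v < n" "slot v = e"
  shows "opt N (before e (Suc v)) (state e A) =
    max (opt N (before e v) (state e A))
        (opt N (before e v) (state e (A - g ` N v)) + card (A \<inter> g ` N v) - 1)"
proof -
  have "before e (Suc v) = insert v (before e v)" "v \<notin> before e v"
    using assms by (auto simp: before_def)
  then show ?thesis
    using opt_insert[of "before e v" v "state e A" N] state_diff[OF assms] card_state_Int[OF assms]
    by simp
qed

lemma before_skip: "slot v \<noteq> e \<Longrightarrow> before e (Suc v) = before e v"
  by (auto simp: before_def less_Suc_eq)

lemma before_next: "before e n = before (Suc e) 0"
  by (auto simp: before_def)

lemma before_start: "before 0 0 = {}"
  by (auto simp: before_def)

text \<open>Slots range over 0, ..., m, hence \<open>m + 1\<close> rounds of the outer loop.\<close>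

lemma before_final: "before (Suc m) 0 = {..<n}"
  using slot_le by (auto simp: before_def less_Suc_eq_le)

lemma state_final: "state (Suc m) {..h} = {..<m}"
  using g_le by (auto simp: state_def)

text \<open>Elements processed so far have slot at most \<open>e\<close>. The set of group
  \<open>e\<close> is in the first state because \<open>0 \<in> A\<close>, and in the second because
  that group has become an earlier one. Whether \<open>0 \<in> B\<close> concerns only the set of
  group \<open>Suc e\<close>, which no processed element can hit.\<close>

lemma opt_next:
  assumes "0 \<in> A" "A - {0} = B - {0}"
  shows "opt N (before (Suc e) 0) (state e A) = opt N (before (Suc e) 0) (state (Suc e) B)"
proof (rule opt_cong)
  define U where "U = \<Union>(N ` before (Suc e) 0)"
  have "c \<in> state e A \<longleftrightarrow> c \<in> state (Suc e) B" if "c \<in> U" for c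
  proof (cases "g c = 0")
    case True
    obtain u where "u \<in> before (Suc e) 0" "c \<in> N u" using \<open>c \<in> U\<close> U_def by blast
    then have "Suc c < Suc e" using slot_eq[of u c] True by (auto simp: before_def)
    then show ?thesis using assms(1) True by (auto simp: state_def)
  next
    case False
    then have "g c \<in> A \<longleftrightarrow> g c \<in> B" using arg_cong[OF assms(2), of "\<lambda>X. g c \<in> X"] by simp
    then show ?thesis using False by (simp add: state_def)
  qed
  then have "state e A \<inter> U = state (Suc e) B \<inter> U" by blast
  then show "state e A \<inter> \<Union>(N ` before (Suc e) 0) = state (Suc e) B \<inter> \<Union>(N ` before (Suc e) 0)"
    by (simp only: U_def)
qed

end

section \<open>The dynamic program\<close>

lemma set_decode_less: "x < 2 ^ i \<Longrightarrow> set_decode x \<subseteq> {..<i}"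
proof
  fix j assume x: "x < 2 ^ i" and "j \<in> set_decode x"
  then have "x div 2 ^ j \<noteq> 0" by (auto simp: set_decode_def intro: ccontr)
  then have "2 ^ j \<le> x" by (simp add: div_eq_0_iff)
  with x have "(2::nat) ^ j < 2 ^ i" by linarith
  then show "j \<in> {..<i}" by simp
qed

lemma set_decode_all: "set_decode (2 ^ i - 1) = {..<i}"
proof -
  have "set_encode {..<i} = 2 ^ i - 1"
    using sum_power2[of i] by (simp add: set_encode_def lessThan_atLeast0)
  then show ?thesis using set_encode_inverse[of "{..<i}"] by simp
qed

text \<open>An unmarked clause has \<open>hit\<close> value 0, so writing \<open>nb\<close> at the
  \<open>hit\<close> value also sets the entry 0 that stands for the current group. Together with
  \<open>o\<close>, the slot, this is all that the table update has to know about
  \<open>v\<close>.\<close>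

definition load_body :: com where
  "load_body =
     If (Diff (Read ''va'' (V ''j'')) (V ''v''))
       Skip
       (Assign ''nb'' (Read ''hit'' (Read ''cl'' (V ''j''))) (Num 1) ;;
        If (Read ''hit'' (Read ''cl'' (V ''j'')))
          Skip
          (''o'' ::= Plus (Read ''cl'' (V ''j'')) (Num 1)))"

definition load :: com where
  "load =
     For ''i'' (Plus (V ''h'') (Num 1)) (Assign ''nb'' (V ''i'') (Num 0)) ;;
     ''o'' ::= Num 0 ;;
     For ''j'' (V ''L'') load_body"

text \<open>
  Subsets of \<open>{..h}\<close> are represented by \<open>set_encode\<close>. For the set \<open>B\<close> with characteristic
  function \<open>nb\<close>, these tables contain the codes of \<open>A - B\<close> and the cardinalities of \<open>A \<inter> B\<close>.
\<close>

definition tables_body :: com where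
  "tables_body =
     Assign ''ct'' (Plus (Read ''pw'' (V ''i'')) (V ''x''))
       (Plus (Read ''ct'' (V ''x'')) (Read ''nb'' (V ''i''))) ;;
     If (Read ''nb'' (V ''i''))
       (Assign ''q'' (Plus (Read ''pw'' (V ''i'')) (V ''x'')) (Read ''q'' (V ''x'')))
       (Assign ''q'' (Plus (Read ''pw'' (V ''i'')) (V ''x''))
          (Plus (Read ''q'' (V ''x'')) (Read ''pw'' (V ''i''))))"

text \<open>The machine has no bit operations, so the tables are built by doubling: round
  \<open>i\<close> derives the entry at \<open>2 ^ i + x\<close> from the entry at \<open>x\<close>,
  for \<open>x < 2 ^ i\<close>.\<close>

definition tables :: com where
  "tables =
     ''q'' ::= Num 0 ;;
     ''ct'' ::= Num 0 ;;
     For ''i'' (Plus (V ''h'') (Num 1)) (For ''x'' (Read ''pw'' (V ''i'')) tables_body)"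

definition improve_body :: com where
  "improve_body =
     ''y'' ::= Minus (Plus (Read ''D'' (Read ''q'' (V ''x''))) (Read ''ct'' (V ''x''))) (Num 1) ;;
     If (Minus (V ''y'') (Read ''D'' (V ''x'')))
       (Assign ''D'' (V ''x'') (V ''y''))
       Skip"

definition improve :: com where
  "improve = For ''x'' (Read ''pw'' (Plus (V ''h'') (Num 1))) improve_body"

text \<open>When a group ends, bit 0 passes to the unmarked set of the next group, which no
  processed element can hit. Both values of the new bit therefore inherit the entry in which the old
  bit was set, so that the set of the finished group counts as one to be hit.\<close>

definition copy :: com where
  "copy =
     For ''x'' (Read ''pw'' (V ''h''))
       (Assign ''D'' (Plus (V ''x'') (V ''x''))
          (Read ''D'' (Plus (Plus (V ''x'') (V ''x'')) (Num 1))))"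

definition powers :: com where
  "powers =
     ''pw'' ::= Num 1 ;;
     For ''i'' (Plus (V ''h'') (Num 1))
       (Assign ''pw'' (Plus (V ''i'') (Num 1)) (Plus (Read ''pw'' (V ''i'')) (Read ''pw'' (V ''i''))))"

text \<open>Every round \<open>e\<close> scans all elements and skips those with another slot; this
  replaces sorting at the price of a polynomial factor.\<close>

definition vertex :: com where
  "vertex = load ;; If (Diff (V ''o'') (V ''e'')) Skip (tables ;; improve)"

definition dynamic :: com where
  "dynamic =
     powers ;;
     For ''e'' (Plus (Read ''in'' (Num 2)) (Num 1))
       (For ''v'' (Read ''in'' (Num 1)) vertex ;; copy)"

lemma writes_program [simp]:
  "writes load_body = {''nb'', ''o''}"
  "writes load = {''i'', ''nb'', ''o'', ''j''}"
  "writes tables_body = {''ct'', ''q''}"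
  "writes tables = {''q'', ''ct'', ''i'', ''x''}"
  "writes improve_body = {''y'', ''D''}"
  "writes improve = {''x'', ''y'', ''D''}"
  "writes vertex = {''i'', ''nb'', ''o'', ''j'', ''q'', ''ct'', ''x'', ''y'', ''D''}"
  "writes copy = {''x'', ''D''}"
  "writes powers = {''pw'', ''i''}"
  by (auto simp: load_def load_body_def tables_def tables_body_def improve_def improve_body_def
      copy_def vertex_def powers_def)

definition incidence :: "(nat \<times> nat) list \<Rightarrow> store \<Rightarrow> bool" where
  "incidence R s \<longleftrightarrow> s ''L'' 0 = length R \<and>
     (\<forall>j<length R. s ''cl'' j = fst (R ! j) \<and> s ''va'' j = snd (R ! j))"

definition clauses_of :: "(nat \<times> nat) list \<Rightarrow> nat \<Rightarrow> nat set" where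
  "clauses_of R v = {c. (c, v) \<in> set R}"

text \<open>The first size bound leaves room for counters and for sums of a table entry, at most
  \<open>m\<close>, and a cardinality, at most \<open>h + 1\<close>. The second one is for codes of
  subsets of \<open>{..h}\<close>.\<close>

locale machine = numbering m n h "clauses_of R" g
  for m n h :: nat and R :: "(nat \<times> nat) list" and g :: "nat \<Rightarrow> nat" +
  fixes b :: nat
  assumes R_snd: "\<And>c v. (c, v) \<in> set R \<Longrightarrow> v < n"
    and h_le: "h \<le> m"
    and size: "length R + 3 * m + n + 10 < wbound b" "2 ^ (h + 1) < wbound b"
begin

abbreviation N where "N \<equiv> clauses_of R"

lemma b_pos: "b > 0"
  using size(1) by (cases b) (auto simp: wbound_def)

definition input :: "store \<Rightarrow> bool" where
  "input s \<longleftrightarrow> incidence R s \<and> s ''h'' 0 = h \<and> s ''hit'' = g \<and> s ''in'' 1 = n \<and> s ''in'' 2 = m"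

lemma input_frame:
  assumes "input s" "\<forall>a. a \<notin> W \<longrightarrow> s' a = s a"
    and "W \<inter> {''L'', ''cl'', ''va'', ''h'', ''hit'', ''in''} = {}"
  shows "input s'"
proof -
  have "s' a = s a" if "a \<in> {''L'', ''cl'', ''va'', ''h'', ''hit'', ''in''}" for a
    using assms(2,3) that by blast
  then show ?thesis using assms(1) by (simp add: input_def incidence_def)
qed

lemma R_nth:
  assumes "j < length R"
  shows "fst (R ! j) < m" "snd (R ! j) < n"
proof -
  have "(fst (R ! j), snd (R ! j)) \<in> set R" using assms by simp
  then show "fst (R ! j) < m" "snd (R ! j) < n"
    using R_snd[of "fst (R ! j)" "snd (R ! j)"] N_sub[of "snd (R ! j)"]
    unfolding clauses_of_def by blast+
qed

lemma runs_load:
  assumes "input s" "s ''v'' 0 = v" "v < n"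
  shows "runs b load s (100 * (h + length R + 3))
    (\<lambda>s'. (\<forall>i\<le>h. s' ''nb'' i = of_bool (i \<in> g ` N v)) \<and> s' ''o'' 0 = slot v)"
proof -
  note [simp] = update_def
  have inp: "s ''h'' 0 = h" "s ''hit'' = g" "s ''L'' 0 = length R"
    "\<And>j. j < length R \<Longrightarrow> s ''cl'' j = fst (R ! j)" "\<And>j. j < length R \<Longrightarrow> s ''va'' j = snd (R ! j)"
    using assms(1) by (auto simp: input_def incidence_def)
  define P where "P j = {c. (c, v) \<in> set (take j R)}" for j
  have P_Suc: "P (Suc j) = (if snd (R ! j) = v then insert (fst (R ! j)) (P j) else P j)"
    if "j < length R" for j
    using that by (cases "R ! j") (auto simp: P_def take_Suc_conv_app_nth)
  have P_all: "P (length R) = N v" by (simp add: P_def clauses_of_def)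
  \<comment> \<open>Which unmarked clause \<open>o\<close> refers to is left open during the scan;
    \<open>slot_eq\<close> makes it unique only at the end.\<close>
  let ?I = "\<lambda>j s'. (\<forall>i\<le>h. s' ''nb'' i = of_bool (i \<in> g ` P j)) \<and>
    ({c \<in> P j. g c = 0} = {} \<and> s' ''o'' 0 = 0 \<or> (\<exists>c \<in> P j. g c = 0 \<and> s' ''o'' 0 = Suc c))"
  have 1: "runs b (For ''i'' (Plus (V ''h'') (Num 1)) (Assign ''nb'' (V ''i'') (Num 0))) s
      ((h + 1 + 1) * (4 + 4 + 13)) (\<lambda>s'. \<forall>i<h+1. s' ''nb'' i = 0)"
  proof (rule runs_conseq[OF runs_For[where I = "\<lambda>k s'. \<forall>i<k. s' ''nb'' i = 0" and T = 4 and N = "h + 1"]])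
    fix i s' assume "i < h + 1" "\<forall>i'<i. s' ''nb'' i' = 0" "s' ''i'' 0 = i"
    moreover have "i < wbound b" "0 < wbound b" using \<open>i < h + 1\<close> size h_le by linarith+
    ultimately show "runs b (Assign ''nb'' (V ''i'') (Num 0)) s' 4
        (\<lambda>s'. \<forall>i'<Suc i. update s' ''i'' 0 (Suc i) ''nb'' i' = 0)"
      by (intro runs_wp b_pos) (simp_all add: less_Suc_eq)
  qed (use b_pos size inp h_le in simp_all)
  have 2: "runs b (For ''j'' (V ''L'') load_body) s1 ((length R + 1) * (40 + 2 + 13)) (?I (length R))"
    if s1: "\<forall>i<h+1. s1 ''nb'' i = 0" "s1 ''o'' 0 = 0" "\<forall>a. a \<notin> {''i'', ''nb'', ''o''} \<longrightarrow> s1 a = s a" for s1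
  proof (rule runs_conseq[OF runs_For[where I = ?I and T = 40 and N = "length R"]])
    fix j s2
    assume j: "j < length R" and I: "?I j s2" and s2: "s2 ''j'' 0 = j"
      and "\<forall>a. a \<notin> insert ''j'' (writes load_body) \<longrightarrow> s2 a = s1 a"
    with s1 inp assms have eqs: "s2 ''va'' j = snd (R ! j)" "s2 ''cl'' j = fst (R ! j)" "s2 ''hit'' = g"
      "s2 ''v'' 0 = v" by (auto simp: load_body_def)
    have "wp (wbound b) load_body (\<lambda>s'. ?I (Suc j) (update s' ''j'' 0 (Suc j))) s2"
    proof (cases "snd (R ! j) = v")
      case False
      then show ?thesis using I s2 eqs size j R_nth[OF j] assms(3) by (simp add: load_body_def P_Suc)
    next
      case True
      have *: "1 < wbound b" "0 < wbound b" "j < wbound b" "v < wbound b" "fst (R ! j) + 1 < wbound b" "g (fst (R ! j)) < wbound b"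
        using size h_le j R_nth[OF j] assms(3) g_le[of "fst (R ! j)"] by auto
      show ?thesis
      proof (cases "g (fst (R ! j)) = 0")
        case False
        then show ?thesis using True I s2 eqs * j by (auto simp add: load_body_def P_Suc)
      next
        case g: True
        then show ?thesis using True I s2 eqs * j by (auto simp add: load_body_def P_Suc)
      qed
    qed
    then show "runs b load_body s2 40 (\<lambda>s'. ?I (Suc j) (update s' ''j'' 0 (Suc j)))"
      by (intro runs_wp b_pos) (simp add: load_body_def)
  qed (use b_pos size inp s1 in \<open>simp_all add: P_def less_Suc_eq_le load_body_def\<close>)
  show ?thesis unfolding load_def
  proof (rule runs_conseq[OF runs_Seq[OF 1]])
    fix s1 assume s1: "\<forall>i<h + 1. s1 ''nb'' i = 0"
      "\<forall>a. a \<notin> writes (For ''i'' (Plus (V ''h'') (Num 1)) (Assign ''nb'' (V ''i'') (Num 0))) \<longrightarrow> s1 a = s a"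
    show "runs b (''o'' ::= Num 0 ;; For ''j'' (V ''L'') load_body) s1
        (3 + (length R + 1) * (40 + 2 + 13)) (?I (length R))"
      by (rule runs_Seq[OF runs_wp[where Q = "\<lambda>s'. s' = update s1 ''o'' 0 0"] 2])
         (use s1 b_pos size in auto)
  next
    fix s' assume "?I (length R) s'"
    then show "(\<forall>i\<le>h. s' ''nb'' i = of_bool (i \<in> g ` N v)) \<and> s' ''o'' 0 = slot v"
      using slot_eq[OF assms(3)] slot_zero[of v] by (auto simp: P_all)
  qed (simp add: algebra_simps)
qed

lemma runs_powers:
  assumes "input s"
  shows "runs b powers s (100 * (h + 2)) (\<lambda>s'. \<forall>i\<le>h+1. s' ''pw'' i = 2 ^ i)"
proof -
  note [simp] = update_def
  have inp: "s ''h'' 0 = h" using assms by (simp add: input_def)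
  let ?body = "Assign ''pw'' (Plus (V ''i'') (Num 1)) (Plus (Read ''pw'' (V ''i'')) (Read ''pw'' (V ''i'')))"
  have 1: "runs b (For ''i'' (Plus (V ''h'') (Num 1)) ?body) s1 ((h + 1 + 1) * (20 + 4 + 13))
      (\<lambda>s'. \<forall>i\<le>h+1. s' ''pw'' i = 2 ^ i)"
    if s1: "s1 ''pw'' 0 = 1" "s1 ''h'' 0 = h" for s1
  proof (rule runs_conseq[OF runs_For[where I = "\<lambda>k s'. \<forall>i\<le>k. s' ''pw'' i = 2 ^ i" and T = 20 and N = "h + 1"]])
    fix i s' assume i: "i < h + 1" "\<forall>j\<le>i. s' ''pw'' j = 2 ^ j" "s' ''i'' 0 = i"
    have "(2::nat) ^ (i + 1) \<le> 2 ^ (h + 1)" by (rule power_increasing) (use i in auto)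
    then have "2 ^ i + 2 ^ i < wbound b" using size(2) by (simp add: mult_2)
    then have "i + 1 < wbound b" "2 ^ i + 2 ^ i < wbound b" "2 ^ i < wbound b" "i < wbound b"
      "0 < wbound b" "1 < wbound b"
      using i(1) size(1) h_le by linarith+
    then show "runs b ?body s' 20 (\<lambda>s'. \<forall>j\<le>Suc i. update s' ''i'' 0 (Suc i) ''pw'' j = 2 ^ j)"
      using i by (intro runs_wp b_pos) (simp_all add: le_Suc_eq)
  qed (use b_pos size h_le s1 in simp_all)
  show ?thesis unfolding powers_def
  proof (rule runs_conseq[OF runs_Seq[OF runs_wp[where Q = "\<lambda>s'. s' = update s ''pw'' 0 1" and T = 3] 1]])
  qed (use inp b_pos size in auto)
qed

lemma runs_tables:
  assumes "input s" "\<forall>i\<le>h+1. s ''pw'' i = 2 ^ i" "\<forall>i\<le>h. s ''nb'' i = of_bool (i \<in> B)"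
  shows "runs b tables s (200 * (h + 2) * (2 ^ (h + 1) + 1))
    (\<lambda>s'. \<forall>x<2 ^ (h + 1). set_decode (s' ''q'' x) = set_decode x - B \<and>
       s' ''ct'' x = card (set_decode x \<inter> B))"
proof -
  note [simp] = update_def
  \<comment> \<open>Correctness of both tables below \<open>k\<close>: the outer loop moves
    \<open>k\<close> from \<open>2 ^ i\<close> to \<open>2 ^ Suc i\<close>, the inner loop one code
    at a time.\<close>
  let ?J = "\<lambda>k s'. \<forall>x<k. set_decode (s' ''q'' x) = set_decode x - B \<and>
       s' ''ct'' x = card (set_decode x \<inter> B)"
  let ?inner = "For ''x'' (Read ''pw'' (V ''i'')) tables_body"
  have inp: "s ''h'' 0 = h" using assms by (simp add: input_def)
  have [simp]: "reads (Read ''pw'' (V ''i'')) = {''pw'', ''i''}" by auto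
  have inner: "runs b ?inner s1 ((2 ^ (h + 1) + 1) * (80 + 3 + 13))
      (\<lambda>s'. ?J (2 ^ Suc i) s')"
    if i: "i \<le> h" and s1: "?J (2 ^ i) s1" "s1 ''i'' 0 = i" "s1 ''pw'' = s ''pw''" "s1 ''nb'' = s ''nb''" for i s1
  proof (rule runs_conseq[OF runs_For[where I = "\<lambda>x. ?J (2 ^ i + x)" and T = 80 and N = "2 ^ i"]])
    fix x s2
    assume x: "x < 2 ^ i" and J: "?J (2 ^ i + x) s2" and x2: "s2 ''x'' 0 = x"
      and "\<forall>a. a \<notin> insert ''x'' (writes tables_body) \<longrightarrow> s2 a = s1 a"
    then have eqs: "s2 ''i'' 0 = i" "s2 ''pw'' i = 2 ^ i" "s2 ''nb'' i = of_bool (i \<in> B)"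
      using s1 i assms by (auto simp: tables_body_def)
    have Jx: "set_decode (s2 ''q'' x) = set_decode x - B" "s2 ''ct'' x = card (set_decode x \<inter> B)"
      using J x by auto
    have dec: "set_decode x \<subseteq> {..<i}" by (rule set_decode_less[OF x])
    have Dx: "set_decode (2 ^ i + x) = insert i (set_decode x)" "i \<notin> set_decode x"
      using dec by (auto intro!: set_decode_plus_power_2)
    have Dq: "set_decode (2 ^ i + s2 ''q'' x) = insert i (set_decode x - B)"
      using Dx(2) Jx(1) by (subst set_decode_plus_power_2) auto
    have cd: "card (insert i (set_decode x) \<inter> B) = s2 ''ct'' x + of_bool (i \<in> B)"
      using Jx(2) Dx(2) by auto
    have "s2 ''q'' x \<le> x" using Jx(1) by (intro subset_decode_imp_le) auto
    moreover have "s2 ''ct'' x \<le> h"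
      using Jx(2) card_mono[of "{..<i}" "set_decode x \<inter> B"] dec i by (simp add: le_infI1)
    moreover have "2 * (2::nat) ^ i \<le> 2 ^ (h + 1)"
      using i power_increasing[of i h "2::nat"] by simp
    ultimately have *: "0 < wbound b" "1 < wbound b" "x < wbound b" "i < wbound b" "2 ^ i < wbound b"
      "2 ^ i + x < wbound b" "s2 ''q'' x < wbound b" "s2 ''ct'' x < wbound b" "s2 ''q'' x + 2 ^ i < wbound b"
      "s2 ''ct'' x + 1 < wbound b"
      using size h_le x i by linarith+
    have "wp (wbound b) tables_body (\<lambda>s'. ?J (2 ^ i + Suc x) (update s' ''x'' 0 (Suc x))) s2"
      using J eqs x2 * Jx Dx(1) Dq cd
      by (cases "i \<in> B") (auto simp add: tables_body_def less_Suc_eq add.commute[of _ "2 ^ i"])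
    then show "runs b tables_body s2 80 (\<lambda>s'. ?J (2 ^ i + Suc x) (update s' ''x'' 0 (Suc x)))"
      by (intro runs_wp b_pos) (simp add: tables_body_def)
  next
    have "(2::nat) ^ i < 2 ^ (h + 1)" using i by (intro power_strict_increasing) auto
    then have "2 ^ i < wbound b" "i < wbound b" using size i h_le by linarith+
    then show "fits (wbound b) (Read ''pw'' (V ''i'')) s1"
      using i s1 assms size by simp
  next
    have "(2::nat) ^ i \<le> 2 ^ (h + 1)" using i by (intro power_increasing) auto
    then show "(2 ^ i + 1) * (80 + nodes (Read ''pw'' (V ''i'')) + 13) \<le> (2 ^ (h + 1) + 1) * (80 + 3 + 13)"
      by simp
  qed (use b_pos i s1 assms in \<open>auto simp: tables_body_def\<close>)
  have outer: "runs b (For ''i'' (Plus (V ''h'') (Num 1)) ?inner) s1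
      ((h + 1 + 1) * ((2 ^ (h + 1) + 1) * (80 + 3 + 13) + 4 + 13)) (?J (2 ^ (h + 1)))"
    if s1: "?J 1 s1" "\<forall>a. a \<notin> {''q'', ''ct''} \<longrightarrow> s1 a = s a" for s1
  proof (rule runs_conseq[OF runs_For[where I = "\<lambda>i. ?J (2 ^ i)" and T = "(2 ^ (h + 1) + 1) * (80 + 3 + 13)" and N = "h + 1"]])
    fix i s2
    assume i: "i < h + 1" "?J (2 ^ i) s2" "s2 ''i'' 0 = i"
      and "\<forall>a. a \<notin> insert ''i'' (writes ?inner) \<longrightarrow> s2 a = s1 a"
    then have "s2 ''pw'' = s ''pw''" "s2 ''nb'' = s ''nb''"
      using s1(2) by (auto simp: tables_body_def)
    then show "runs b ?inner s2 ((2 ^ (h + 1) + 1) * (80 + 3 + 13))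
        (\<lambda>s'. ?J (2 ^ Suc i) (update s' ''i'' 0 (Suc i)))"
      using i by (intro runs_conseq[OF inner[of i]]) auto
  qed (use b_pos size h_le inp s1 in \<open>simp_all add: tables_body_def\<close>)
  show ?thesis unfolding tables_def
  proof (rule runs_conseq)
    show "runs b (''q'' ::= Num 0 ;; ''ct'' ::= Num 0 ;; For ''i'' (Plus (V ''h'') (Num 1)) ?inner) s
        (3 + (3 + ((h + 1 + 1) * ((2 ^ (h + 1) + 1) * (80 + 3 + 13) + 4 + 13)))) (?J (2 ^ (h + 1)))"
      by (rule runs_Seq[OF runs_wp[where Q = "\<lambda>s'. s' ''q'' 0 = 0"]
            runs_Seq[OF runs_wp[where Q = "\<lambda>s'. s' ''q'' 0 = 0 \<and> s' ''ct'' 0 = 0"] outer]])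
         (use b_pos size in auto)
  qed (auto simp: algebra_simps)
qed

text \<open>The update is in place although the recursion asks for old values. An entry at
  \<open>q x\<close> is a fixed point of the update, because \<open>q\<close> is idempotent and
  \<open>ct (q x) = 0\<close>; so it does not matter whether it has already been visited.\<close>

lemma runs_improve:
  assumes "input s" "\<forall>i\<le>h+1. s ''pw'' i = 2 ^ i"
    and q: "\<forall>x<2 ^ (h + 1). s ''q'' x \<le> x \<and> s ''q'' (s ''q'' x) = s ''q'' x \<and> s ''ct'' (s ''q'' x) = 0"
    and small: "\<forall>x<2 ^ (h + 1). s ''ct'' x \<le> h + 1 \<and> s ''D'' x \<le> m"
  shows "runs b improve s (200 * (2 ^ (h + 1) + 1))
    (\<lambda>s'. \<forall>x<2 ^ (h + 1). s' ''D'' x = max (s ''D'' x) (s ''D'' (s ''q'' x) + s ''ct'' x - 1))"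
proof -
  note [simp] = update_def
  let ?v = "\<lambda>x. max (s ''D'' x) (s ''D'' (s ''q'' x) + s ''ct'' x - 1)"
  let ?I = "\<lambda>i s'. \<forall>x<2 ^ (h + 1). s' ''D'' x = (if x < i then ?v x else s ''D'' x)"
  have inp: "s ''h'' 0 = h" using assms by (simp add: input_def)
  show ?thesis unfolding improve_def
  proof (rule runs_conseq[OF runs_For[where I = ?I and T = 80 and N = "2 ^ (h + 1)"]])
    fix x s2
    assume x: "x < 2 ^ (h + 1)" and I: "?I x s2" and x2: "s2 ''x'' 0 = x"
      and "\<forall>a. a \<notin> insert ''x'' (writes improve_body) \<longrightarrow> s2 a = s a"
    then have eqs: "s2 ''q'' = s ''q''" "s2 ''ct'' = s ''ct''" by (auto simp: improve_body_def)
    have qx: "s ''q'' x \<le> x" "s ''q'' x < 2 ^ (h + 1)" using q x by (auto intro: le_less_trans)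
    have D: "s2 ''D'' x = s ''D'' x" "s2 ''D'' (s ''q'' x) = s ''D'' (s ''q'' x)"
      using I x qx q by auto
    have *: "s ''D'' x \<le> m" "s ''D'' (s ''q'' x) \<le> m" "s ''ct'' x \<le> h + 1"
      using small x qx by auto
    then have *: "0 < wbound b" "1 < wbound b" "x < wbound b" "s ''q'' x < wbound b" "s ''ct'' x < wbound b"
      "s ''D'' x < wbound b" "s ''D'' (s ''q'' x) < wbound b" "s ''D'' (s ''q'' x) + s ''ct'' x < wbound b"
      "s ''D'' (s ''q'' x) + s ''ct'' x - 1 < wbound b"
      using size h_le x qx by linarith+
    have "wp (wbound b) improve_body (\<lambda>s'. ?I (Suc x) (update s' ''x'' 0 (Suc x))) s2"
    proof (cases "s ''D'' (s ''q'' x) + s ''ct'' x - 1 \<le> s ''D'' x")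
      case True
      then show ?thesis using I x2 eqs D * by (simp add: improve_body_def less_Suc_eq)
    next
      case False
      then show ?thesis using I x2 eqs D * by (simp add: improve_body_def less_Suc_eq)
    qed
    then show "runs b improve_body s2 80 (\<lambda>s'. ?I (Suc x) (update s' ''x'' 0 (Suc x)))"
      by (intro runs_wp b_pos) (simp add: improve_body_def)
  qed (use b_pos size h_le inp assms(2) in \<open>simp_all add: improve_body_def\<close>)
qed

lemma runs_copy:
  assumes "input s" "\<forall>i\<le>h+1. s ''pw'' i = 2 ^ i" "\<forall>x<2 ^ (h + 1). s ''D'' x \<le> m"
  shows "runs b copy s (200 * (2 ^ (h + 1) + 1))
    (\<lambda>s'. \<forall>x<2 ^ (h + 1). s' ''D'' x = s ''D'' (2 * (x div 2) + 1))"
proof -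
  note [simp] = update_def
  let ?I = "\<lambda>i s'. \<forall>x<2 ^ (h + 1). s' ''D'' x = (if even x \<and> x div 2 < i then s ''D'' (x + 1) else s ''D'' x)"
  have inp: "s ''h'' 0 = h" using assms by (simp add: input_def)
  let ?body = "Assign ''D'' (Plus (V ''x'') (V ''x''))
          (Read ''D'' (Plus (Plus (V ''x'') (V ''x'')) (Num 1)))"
  show ?thesis unfolding copy_def
  proof (rule runs_conseq[OF runs_For[where I = ?I and T = 20 and N = "2 ^ h"]])
    fix x s2
    assume x: "x < 2 ^ h" and I: "?I x s2" and x2: "s2 ''x'' 0 = x"
    have xx: "x + x + 1 < 2 ^ (h + 1)" using x by simp
    have D: "s2 ''D'' (x + x + 1) = s ''D'' (x + x + 1)" using I xx by simp
    have *: "0 < wbound b" "1 < wbound b" "x < wbound b" "x + x < wbound b" "x + x + 1 < wbound b"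
      "s ''D'' (x + x + 1) < wbound b"
      using size xx assms(3)[rule_format, OF xx] by linarith+
    have "even y \<and> y div 2 < Suc x \<longleftrightarrow> even y \<and> y div 2 < x \<or> y = x + x" for y
      by (auto elim!: evenE)
    then have "wp (wbound b) ?body (\<lambda>s'. ?I (Suc x) (update s' ''x'' 0 (Suc x))) s2"
      using I x2 D * by auto
    then show "runs b ?body s2 20 (\<lambda>s'. ?I (Suc x) (update s' ''x'' 0 (Suc x)))"
      by (intro runs_wp b_pos) simp_all
  next
    fix s' assume I: "?I (2 ^ h) s'"
    show "\<forall>x<2 ^ (h + 1). s' ''D'' x = s ''D'' (2 * (x div 2) + 1)"
    proof (intro allI impI)
      fix x :: nat assume x: "x < 2 ^ (h + 1)"
      then have "x div 2 < 2 ^ h" by auto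
      then show "s' ''D'' x = s ''D'' (2 * (x div 2) + 1)"
        using I x by (cases "even x") auto
    qed
  qed (use b_pos size h_le inp assms(2) in simp_all)
qed

section \<open>Correctness of the dynamic program\<close>

definition table :: "nat \<Rightarrow> nat \<Rightarrow> store \<Rightarrow> bool" where
  "table e v s \<longleftrightarrow> (\<forall>x<2 ^ (h + 1). s ''D'' x = opt N (before e v) (state e (set_decode x)))"

lemma table_le: "table e v s \<Longrightarrow> x < 2 ^ (h + 1) \<Longrightarrow> s ''D'' x \<le> m"
  using opt_le_card[of "before e v" "state e (set_decode x)" N] card_state[of e "set_decode x"]
  by (simp add: table_def)

lemma runs_tables_improve:
  assumes "input s" "\<forall>i\<le>h+1. s ''pw'' i = 2 ^ i" "\<forall>i\<le>h. s ''nb'' i = of_bool (i \<in> g ` N v)"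
    and "table e v s" "v < n" "slot v = e"
  shows "runs b (tables ;; improve) s (200 * (h + 2) * (2 ^ (h + 1) + 1) + 200 * (2 ^ (h + 1) + 1))
    (table e (Suc v))"
proof (rule runs_Seq[OF runs_tables[OF assms(1-3)]])
  let ?B = "g ` N v"
  fix s1
  assume s1: "\<forall>x<2 ^ (h + 1). set_decode (s1 ''q'' x) = set_decode x - ?B \<and>
       s1 ''ct'' x = card (set_decode x \<inter> ?B)"
    and "\<forall>a. a \<notin> writes tables \<longrightarrow> s1 a = s a"
  then have eqs: "s1 ''D'' = s ''D''" "s1 ''pw'' = s ''pw''" and inp: "input s1"
    using input_frame[OF assms(1), of "writes tables" s1] by auto
  have q: "s1 ''q'' x \<le> x" "s1 ''q'' x < 2 ^ (h + 1)" "s1 ''q'' (s1 ''q'' x) = s1 ''q'' x"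
    "s1 ''ct'' (s1 ''q'' x) = 0" if x: "x < 2 ^ (h + 1)" for x
  proof -
    have sx: "set_decode (s1 ''q'' x) = set_decode x - ?B" using s1 x by simp
    then show le: "s1 ''q'' x \<le> x" by (intro subset_decode_imp_le) auto
    with x show lt: "s1 ''q'' x < 2 ^ (h + 1)" by (rule le_less_trans[rotated])
    have "set_decode (s1 ''q'' (s1 ''q'' x)) = set_decode (s1 ''q'' x)"
      using s1 lt sx by auto
    then show "s1 ''q'' (s1 ''q'' x) = s1 ''q'' x" by (metis set_decode_inverse)
    have "set_decode (s1 ''q'' x) \<inter> ?B = {}" using sx by auto
    then show "s1 ''ct'' (s1 ''q'' x) = 0" using s1 lt by simp
  qed
  have ct: "s1 ''ct'' x \<le> h + 1" if x: "x < 2 ^ (h + 1)" for x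
  proof -
    have "card (set_decode x \<inter> ?B) \<le> card {..<h + 1}"
      using set_decode_less[OF x] by (intro card_mono) auto
    then show ?thesis using s1 x by simp
  qed
  show "runs b improve s1 (200 * (2 ^ (h + 1) + 1)) (table e (Suc v))"
  proof (rule runs_conseq[OF runs_improve[OF inp]])
    fix s' assume s': "\<forall>x<2 ^ (h + 1). s' ''D'' x = max (s1 ''D'' x) (s1 ''D'' (s1 ''q'' x) + s1 ''ct'' x - 1)"
    show "table e (Suc v) s'" unfolding table_def opt_step[OF assms(5,6)]
      using s' s1 eqs assms(4) q(2) by (simp add: table_def)
  qed (use assms(2) eqs q ct table_le[OF assms(4)] in auto)
qed

lemma runs_vertex:
  assumes "input s" "\<forall>i\<le>h+1. s ''pw'' i = 2 ^ i" "s ''v'' 0 = v" "s ''e'' 0 = e"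
    and "table e v s" "v < n" "e \<le> m"
  shows "runs b vertex s (900 * ((h + length R + 3) * (2 ^ (h + 1) + 1))) (table e (Suc v))"
proof -
  let ?T = "200 * (h + 2) * (2 ^ (h + 1) + 1) + 200 * (2 ^ (h + 1) + 1)"
  have "runs b vertex s (100 * (h + length R + 3) + (nodes (Diff (V ''o'') (V ''e'')) + 1 + ?T)) (table e (Suc v))"
    unfolding vertex_def
  proof (rule runs_Seq[OF runs_load[OF assms(1,3,6)]])
    fix s1
    assume s1: "(\<forall>i\<le>h. s1 ''nb'' i = of_bool (i \<in> g ` N v)) \<and> s1 ''o'' 0 = slot v"
      and fr: "\<forall>a. a \<notin> writes load \<longrightarrow> s1 a = s a"
    from fr have eqs: "s1 ''pw'' = s ''pw''" "s1 ''e'' = s ''e''" "s1 ''D'' = s ''D''" and inp: "input s1"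
      using input_frame[OF assms(1), of "writes load" s1] by auto
    have tab: "table e v s1" using assms(5) eqs by (simp add: table_def)
    show "runs b (If (Diff (V ''o'') (V ''e'')) Skip (tables ;; improve)) s1
        (nodes (Diff (V ''o'') (V ''e'')) + 1 + ?T) (table e (Suc v))"
    proof (rule runs_If[OF b_pos])
      show "fits (wbound b) (Diff (V ''o'') (V ''e'')) s1"
        using s1 eqs assms size slot_le[OF assms(6)] by simp
    next
      assume "aval (Diff (V ''o'') (V ''e'')) s1 \<noteq> 0"
      then have "slot v \<noteq> e" using s1 eqs assms by simp
      then show "runs b Skip s1 ?T (table e (Suc v))"
        using tab by (intro runs_wp b_pos) (simp_all add: table_def before_skip)
    next
      assume "aval (Diff (V ''o'') (V ''e'')) s1 = 0"
      then have "slot v = e" using s1 eqs assms by simp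
      then show "runs b (tables ;; improve) s1 ?T (table e (Suc v))"
        using s1 eqs assms inp tab by (intro runs_tables_improve) auto
    qed
  qed
  then show ?thesis by (rule runs_conseq) (auto simp: algebra_simps)
qed

text \<open>After the last round all elements are processed, and \<open>2 ^ (h + 1) - 1\<close> is
  the code of \<open>{..h}\<close>, in whose state every set is still to be hit; this entry is the
  unrestricted optimum. Initially the table may be all zero since no element has been
  processed.\<close>

lemma runs_dynamic:
  assumes "input s" "\<forall>x. s ''D'' x = 0"
  shows "runs b dynamic s (1500 * ((m + 2) * (n + 1) * ((h + length R + 3) * (2 ^ (h + 1) + 1))))
    (\<lambda>s'. s' ''pw'' (h + 1) = 2 ^ (h + 1) \<and> s' ''D'' (2 ^ (h + 1) - 1) = opt N {..<n} {..<m})"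
proof -
  define K where "K = (h + length R + 3) * (2 ^ (h + 1) + 1)"
  have K: "2 ^ (h + 1) + 1 \<le> K" "h + 2 \<le> K" "1 \<le> K" by (auto simp: K_def algebra_simps)
  note [simp] = update_def
  let ?pw = "\<lambda>s. \<forall>i\<le>h+1. s ''pw'' i = 2 ^ i"
  let ?body = "For ''v'' (Read ''in'' (Num 1)) vertex ;; copy"
  have vs: "runs b (For ''v'' (Read ''in'' (Num 1)) vertex) s1 ((n + 1) * (900 * K + 2 + 13)) (table e n)"
    if s1: "input s1" "?pw s1" "table e 0 s1" "s1 ''e'' 0 = e" "e \<le> m" for s1 e
  proof (rule runs_conseq[OF runs_For[where I = "table e" and T = "900 * K" and N = n]])
    fix v s2
    assume v: "v < n" "table e v s2" "s2 ''v'' 0 = v"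
      and fr: "\<forall>a. a \<notin> insert ''v'' (writes vertex) \<longrightarrow> s2 a = s1 a"
    then have "input s2" "?pw s2" "s2 ''e'' 0 = e"
      using s1 input_frame[OF s1(1) fr] by auto
    from runs_vertex[OF this(1,2) v(3) this(3) v(2,1) s1(5)]
    show "runs b vertex s2 (900 * K) (\<lambda>s'. table e (Suc v) (update s' ''v'' 0 (Suc v)))"
      unfolding K_def by (rule runs_conseq) (auto simp: table_def)
  qed (use b_pos size s1 in \<open>auto simp: input_def table_def\<close>)
  have group: "runs b ?body s1 (1200 * ((n + 1) * K)) (table (Suc e) 0)"
    if s1: "input s1" "?pw s1" "table e 0 s1" "s1 ''e'' 0 = e" "e \<le> m" for s1 e
  proof (rule runs_conseq[OF runs_Seq[OF vs[OF s1]]])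
    fix s2 assume tab: "table e n s2" and fr: "\<forall>a. a \<notin> writes (For ''v'' (Read ''in'' (Num 1)) vertex) \<longrightarrow> s2 a = s1 a"
    then have "input s2" "?pw s2"
      using s1 input_frame[OF s1(1) fr] by auto
    note copy = runs_copy[OF this]
    have "\<forall>x<2 ^ (h + 1). s2 ''D'' x \<le> m" using table_le[OF tab] by blast
    from copy[OF this] show "runs b copy s2 (200 * (2 ^ (h + 1) + 1)) (table (Suc e) 0)"
    proof (rule runs_conseq)
      fix s' assume s': "\<forall>x<2 ^ (h + 1). s' ''D'' x = s2 ''D'' (2 * (x div 2) + 1)"
      show "table (Suc e) 0 s'" unfolding table_def
      proof (intro allI impI)
        fix x :: nat assume x: "x < 2 ^ (h + 1)"
        \<comment> \<open>The code \<open>x\<close> with bit 0 switched on, as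
          \<open>opt_next\<close> requires of the old state.\<close>
        let ?y = "2 * (x div 2) + 1"
        have y: "?y < 2 ^ (h + 1)" using x by (cases "even x") (auto elim!: evenE oddE)
        have "set_decode ?y - {0} = set_decode x - {0}"
        proof (intro set_eqI)
          fix i show "i \<in> set_decode ?y - {0} \<longleftrightarrow> i \<in> set_decode x - {0}" by (cases i) auto
        qed
        then have "opt N (before (Suc e) 0) (state e (set_decode ?y)) =
            opt N (before (Suc e) 0) (state (Suc e) (set_decode x))"
          by (intro opt_next) auto
        then show "s' ''D'' x = opt N (before (Suc e) 0) (state (Suc e) (set_decode x))"
          using s' x y tab by (simp add: table_def before_next)
      qed
    qed auto
  next
    have "(n + 1) * (900 * K + 2 + 13) \<le> (n + 1) * (915 * K)" using K by (intro mult_le_mono) auto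
    moreover have "200 * (2 ^ (h + 1) + 1) \<le> 200 * ((n + 1) * K)" using K(1) by (simp add: trans_le_add1)
    ultimately show "(n + 1) * (900 * K + 2 + 13) + 200 * (2 ^ (h + 1) + 1) \<le> 1200 * ((n + 1) * K)"
      by simp
  qed
  have "runs b dynamic s (100 * (h + 2) + (m + 1 + 1) * (1200 * ((n + 1) * K) + 4 + 13))
      (\<lambda>s'. s' ''pw'' (h + 1) = 2 ^ (h + 1) \<and> table (m + 1) 0 s')"
    unfolding dynamic_def
  proof (rule runs_Seq[OF runs_powers[OF assms(1)]])
    fix s1 assume s1: "?pw s1" and fr: "\<forall>a. a \<notin> writes powers \<longrightarrow> s1 a = s a"
    then have inp: "input s1" and D: "s1 ''D'' = s ''D''"
      using input_frame[OF assms(1) fr] by auto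
    show "runs b (For ''e'' (Plus (Read ''in'' (Num 2)) (Num 1)) ?body) s1
       ((m + 1 + 1) * (1200 * ((n + 1) * K) + 4 + 13))
       (\<lambda>s'. s' ''pw'' (h + 1) = 2 ^ (h + 1) \<and> table (m + 1) 0 s')"
    proof (rule runs_conseq[OF runs_For[where I = "\<lambda>e. table e 0" and T = "1200 * ((n + 1) * K)" and N = "m + 1"]])
      fix e s2
      assume e: "e < m + 1" "table e 0 s2" "s2 ''e'' 0 = e"
        and fr: "\<forall>a. a \<notin> insert ''e'' (writes ?body) \<longrightarrow> s2 a = s1 a"
      then have "input s2" "?pw s2"
        using s1 input_frame[OF inp fr] by auto
      then show "runs b ?body s2 (1200 * ((n + 1) * K)) (\<lambda>s'. table (Suc e) 0 (update s' ''e'' 0 (Suc e)))"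
        using e by (intro runs_conseq[OF group]) (auto simp: table_def)
    qed (use b_pos size inp D s1 assms(2) in \<open>auto simp: input_def table_def before_start\<close>)
  qed
  then show ?thesis
  proof (rule runs_conseq)
    define X where "X = (n + 1) * K"
    have X: "K \<le> X" "1 \<le> X" using K(3) by (auto simp: X_def)
    define Z where "Z = (m + 2) * X"
    have "K \<le> Z" using X(1) by (simp add: Z_def trans_le_add1)
    then have sum: "100 * (h + 2) + a \<le> 1500 * Z" if "a \<le> 1217 * Z" for a
      using K(2) that by simp
    have "(m + 2) * (1200 * X + 4 + 13) \<le> (m + 2) * (1217 * X)"
      using X(2) by (intro mult_le_mono) auto
    then have "(m + 1 + 1) * (1200 * X + 4 + 13) \<le> 1217 * Z"
      by (simp add: Z_def mult.assoc mult.left_commute)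
    from sum[OF this] show "100 * (h + 2) + (m + 1 + 1) * (1200 * ((n + 1) * K) + 4 + 13) \<le>
        1500 * ((m + 2) * (n + 1) * ((h + length R + 3) * (2 ^ (h + 1) + 1)))"
      by (simp only: Z_def X_def K_def mult.assoc)
  next
    fix s' assume "s' ''pw'' (h + 1) = 2 ^ (h + 1) \<and> table (m + 1) 0 s'"
    then show "s' ''pw'' (h + 1) = 2 ^ (h + 1) \<and> s' ''D'' (2 ^ (h + 1) - 1) = opt N {..<n} {..<m}"
      using state_final before_final set_decode_all[of "h + 1"]
      by (simp add: table_def lessThan_Suc_atMost)
  qed
qed

end

section \<open>The greedy phase\<close>

definition count_body :: com where
  "count_body =
     If (Diff (Read ''va'' (V ''j'')) (V ''v''))
       Skip
       (If (Read ''hit'' (Read ''cl'' (V ''j'')))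
         Skip
         (''cnt'' ::= Plus (V ''cnt'') (Num 1)))"

definition mark_body :: com where
  "mark_body =
     If (Diff (Read ''va'' (V ''j'')) (V ''v''))
       Skip
       (If (Read ''hit'' (Read ''cl'' (V ''j'')))
         Skip
         (''h'' ::= Plus (V ''h'') (Num 1) ;;
          Assign ''hit'' (Read ''cl'' (V ''j'')) (V ''h'')))"

text \<open>The guard \<open>cnt - 1\<close> is nonzero exactly for at least two new clauses. Marks
  are handed out as 1, 2, ... in order of discovery, so that \<open>hit\<close> can later serve as
  the numbering.\<close>

definition select :: com where
  "select =
     ''cnt'' ::= Num 0 ;;
     For ''j'' (V ''L'') count_body ;;
     If (Minus (V ''cnt'') (Num 1))
       (''s'' ::= Plus (V ''s'') (Num 1) ;; For ''j'' (V ''L'') mark_body)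
       Skip"

definition greedy :: com where
  "greedy = For ''v'' (Read ''in'' (Num 1)) select"

lemma writes_greedy [simp]:
  "writes count_body = {''cnt''}"
  "writes mark_body = {''h'', ''hit''}"
  "writes select = {''cnt'', ''j'', ''s'', ''h'', ''hit''}"
  "writes greedy = {''v'', ''cnt'', ''j'', ''s'', ''h'', ''hit''}"
  by (auto simp: count_body_def mark_body_def select_def greedy_def)

lemma bij_betw_new:
  assumes "bij_betw f {c. f c \<noteq> 0} {1..h}" "f c = 0"
  shows "bij_betw (f(c := Suc h)) {x. (f(c := Suc h)) x \<noteq> 0} {1..Suc h}"
proof -
  have "bij_betw (f(c := Suc h)) {c. f c \<noteq> 0} {1..h}"
    using assms by (subst bij_betw_cong[of _ _ f]) auto
  then have "bij_betw (f(c := Suc h)) ({c. f c \<noteq> 0} \<union> {c}) ({1..h} \<union> {(f(c := Suc h)) c})"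
    using assms(2) by (intro notIn_Un_bij_betw) auto
  moreover have "{c. f c \<noteq> 0} \<union> {c} = {x. (f(c := Suc h)) x \<noteq> 0}" by auto
  moreover have "{1..h} \<union> {(f(c := Suc h)) c} = {1..Suc h}" by auto
  ultimately show ?thesis by simp
qed

text \<open>Distinctness of \<open>R\<close> makes counting list entries the same as counting
  clauses.\<close>

locale occurrences =
  fixes b m n :: nat and R :: "(nat \<times> nat) list"
  assumes R_less: "\<And>c v. (c, v) \<in> set R \<Longrightarrow> c < m \<and> v < n"
    and R_distinct: "distinct R"
    and R_size: "length R + 3 * m + n + 10 < wbound b"
begin

abbreviation N where "N \<equiv> clauses_of R"

lemma b_pos: "b > 0"
  using R_size by (cases b) (auto simp: wbound_def)

lemma N_less: "N v \<subseteq> {..<m}"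
  using R_less by (auto simp: clauses_of_def)

lemma finite_N [simp]: "finite (N v)"
  by (rule finite_subset[OF N_less]) simp

definition part :: "nat \<Rightarrow> nat \<Rightarrow> nat set" where
  "part v j = {c. (c, v) \<in> set (take j R)}"

lemma part_0 [simp]: "part v 0 = {}"
  by (simp add: part_def)

lemma part_length [simp]: "part v (length R) = N v"
  by (simp add: part_def clauses_of_def)

lemma part_subset: "part v j \<subseteq> {..<m}"
  using R_less set_take_subset[of j R] by (auto simp: part_def)

lemma finite_part [simp]: "finite (part v j)"
  by (rule finite_subset[OF part_subset]) simp

lemma part_Suc:
  assumes "j < length R"
  shows "part v (Suc j) = (if snd (R ! j) = v then insert (fst (R ! j)) (part v j) else part v j)"
    "snd (R ! j) = v \<Longrightarrow> fst (R ! j) \<notin> part v j"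
proof -
  show "part v (Suc j) = (if snd (R ! j) = v then insert (fst (R ! j)) (part v j) else part v j)"
    using assms by (cases "R ! j") (auto simp: part_def take_Suc_conv_app_nth)
  have "R ! j \<notin> set (take j R)"
    using R_distinct assms by (auto simp: in_set_conv_nth nth_eq_iff_index_eq)
  then show "snd (R ! j) = v \<Longrightarrow> fst (R ! j) \<notin> part v j"
    by (cases "R ! j") (auto simp: part_def)
qed

lemma nth_less:
  assumes "j < length R"
  shows "fst (R ! j) < m" "snd (R ! j) < n"
  using R_less[of "fst (R ! j)" "snd (R ! j)"] assms by auto

definition marking :: "store \<Rightarrow> bool" where
  "marking s \<longleftrightarrow> {c. s ''hit'' c \<noteq> 0} \<subseteq> {..<m} \<and>
     bij_betw (s ''hit'') {c. s ''hit'' c \<noteq> 0} {1..s ''h'' 0}"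

lemma marking_card: "marking s \<Longrightarrow> s ''h'' 0 = card {c. s ''hit'' c \<noteq> 0}"
  by (auto simp: marking_def dest!: bij_betw_same_card)

lemma marking_le:
  assumes "marking s"
  shows "s ''h'' 0 \<le> m" "s ''hit'' c \<le> m"
proof -
  have "card {c. s ''hit'' c \<noteq> 0} \<le> card {..<m}"
    using assms by (intro card_mono) (auto simp: marking_def)
  then show le: "s ''h'' 0 \<le> m" using marking_card[OF assms] by simp
  show "s ''hit'' c \<le> m"
  proof (cases "s ''hit'' c = 0")
    case False
    then have "s ''hit'' c \<in> {1..s ''h'' 0}" using assms by (auto simp: marking_def bij_betw_def)
    then show ?thesis using le by simp
  qed simp
qed

lemma marking_cong: "marking s \<Longrightarrow> s' ''hit'' = s ''hit'' \<Longrightarrow> s' ''h'' = s ''h'' \<Longrightarrow> marking s'"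
  by (simp add: marking_def)

lemma runs_count:
  assumes "incidence R s" "s ''v'' 0 = v" "v < n" "marking s" "s ''cnt'' 0 = 0"
  shows "runs b (For ''j'' (V ''L'') count_body) s ((length R + 1) * 100)
    (\<lambda>s'. s' ''cnt'' 0 = card {c \<in> N v. s ''hit'' c = 0})"
proof -
  note [simp] = update_def
  let ?I = "\<lambda>j s'. s' ''cnt'' 0 = card {c \<in> part v j. s ''hit'' c = 0}"
  show ?thesis
  proof (rule runs_conseq[OF runs_For[where I = ?I and T = 60 and N = "length R"]])
    fix j s2
    assume j: "j < length R" and I: "?I j s2" and s2: "s2 ''j'' 0 = j"
      and fr: "\<forall>a. a \<notin> insert ''j'' (writes count_body) \<longrightarrow> s2 a = s a"
    have eqs: "s2 ''va'' j = snd (R ! j)" "s2 ''cl'' j = fst (R ! j)" "s2 ''v'' 0 = v"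
      "s2 ''hit'' = s ''hit''"
      using fr assms(1,2) j by (auto simp: incidence_def)
    have cnt: "card {c \<in> part v j. s ''hit'' c = 0} \<le> card {..<m}"
      using part_subset[of v j] by (intro card_mono) auto
    have *: "0 < wbound b" "1 < wbound b" "j < wbound b" "v < wbound b" "fst (R ! j) < wbound b"
      "snd (R ! j) < wbound b" "s2 ''cnt'' 0 < wbound b" "s2 ''cnt'' 0 + 1 < wbound b"
      "s ''hit'' (fst (R ! j)) < wbound b"
      using R_size j nth_less[OF j] assms(3) marking_le(2)[OF assms(4), of "fst (R ! j)"] cnt I by auto
    have "wp (wbound b) count_body (\<lambda>s'. ?I (Suc j) (update s' ''j'' 0 (Suc j))) s2"
    proof (cases "snd (R ! j) = v")
      case False
      then show ?thesis using I s2 eqs * part_Suc[OF j] by (simp add: count_body_def)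
    next
      case True
      note p = part_Suc(2)[OF j True] part_Suc(1)[OF j, of v]
      show ?thesis
      proof (cases "s ''hit'' (fst (R ! j)) = 0")
        case g: True
        then have "{c \<in> part v (Suc j). s ''hit'' c = 0} = insert (fst (R ! j)) {c \<in> part v j. s ''hit'' c = 0}"
          using p True by auto
        then show ?thesis using True g I s2 eqs * p by (simp add: count_body_def)
      next
        case False
        then have "{c \<in> part v (Suc j). s ''hit'' c = 0} = {c \<in> part v j. s ''hit'' c = 0}"
          using p True by auto
        then show ?thesis using True False I s2 eqs * by (simp add: count_body_def)
      qed
    qed
    then show "runs b count_body s2 60 (\<lambda>s'. ?I (Suc j) (update s' ''j'' 0 (Suc j)))"
      by (intro runs_wp b_pos) (simp add: count_body_def)
  qed (use b_pos R_size assms in \<open>auto simp: incidence_def\<close>)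
qed

lemma runs_mark:
  assumes "incidence R s" "s ''v'' 0 = v" "v < n" "marking s"
  shows "runs b (For ''j'' (V ''L'') mark_body) s ((length R + 1) * 100)
    (\<lambda>s'. marking s' \<and> {c. s' ''hit'' c \<noteq> 0} = {c. s ''hit'' c \<noteq> 0} \<union> N v)"
proof -
  note [simp] = update_def
  let ?I = "\<lambda>j s'. marking s' \<and> {c. s' ''hit'' c \<noteq> 0} = {c. s ''hit'' c \<noteq> 0} \<union> part v j"
  show ?thesis
  proof (rule runs_conseq[OF runs_For[where I = ?I and T = 60 and N = "length R"]])
    fix j s2
    assume j: "j < length R" and I: "?I j s2" and s2: "s2 ''j'' 0 = j"
      and fr: "\<forall>a. a \<notin> insert ''j'' (writes mark_body) \<longrightarrow> s2 a = s a"
    let ?c = "fst (R ! j)"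
    have eqs: "s2 ''va'' j = snd (R ! j)" "s2 ''cl'' j = fst (R ! j)" "s2 ''v'' 0 = v"
      using fr assms(1,2) j by (auto simp: incidence_def)
    have le: "s2 ''h'' 0 \<le> m" "s2 ''hit'' ?c \<le> m" using marking_le I by blast+
    have *: "0 < wbound b" "1 < wbound b" "j < wbound b" "v < wbound b" "?c < wbound b"
      "snd (R ! j) < wbound b" "s2 ''h'' 0 < wbound b" "s2 ''h'' 0 + 1 < wbound b" "s2 ''hit'' ?c < wbound b"
      using R_size j nth_less[OF j] assms(3) le by auto
    \<comment> \<open>Keeps the bijection in the invariant hidden from the simplifier while it
      evaluates \<open>wp\<close>.\<close>
    define Q where "Q = ?I (Suc j)"
    have "wp (wbound b) mark_body (\<lambda>s'. Q (update s' ''j'' 0 (Suc j))) s2"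
    proof (cases "snd (R ! j) = v")
      case False
      then have "Q (update s2 ''j'' 0 (Suc j))"
        unfolding Q_def using I part_Suc(1)[OF j, of v] by (auto simp: marking_def)
      then show ?thesis using False s2 eqs * by (simp add: mark_body_def)
    next
      case True
      note p = part_Suc(1)[OF j, of v]
      show ?thesis
      proof (cases "s2 ''hit'' ?c = 0")
        case g: True
        let ?s = "update (update (update s2 ''h'' 0 (s2 ''h'' 0 + 1)) ''hit'' ?c (s2 ''h'' 0 + 1)) ''j'' 0 (Suc j)"
        have dom: "{c. ?s ''hit'' c \<noteq> 0} = insert ?c {c. s2 ''hit'' c \<noteq> 0}" by auto
        have eq: "?s ''hit'' = (s2 ''hit'')(?c := Suc (s2 ''h'' 0))" "?s ''h'' 0 = Suc (s2 ''h'' 0)"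
          by simp_all
        have "bij_betw (s2 ''hit'') {c. s2 ''hit'' c \<noteq> 0} {1..s2 ''h'' 0}"
          using I unfolding marking_def by blast
        then have "bij_betw (?s ''hit'') {c. ?s ''hit'' c \<noteq> 0} {1..?s ''h'' 0}"
          unfolding eq using g by (rule bij_betw_new)
        moreover have "{c. ?s ''hit'' c \<noteq> 0} \<subseteq> {..<m}"
          unfolding dom using I nth_less(1)[OF j] by (auto simp: marking_def)
        ultimately have "marking ?s" unfolding marking_def by blast
        moreover have "{c. ?s ''hit'' c \<noteq> 0} = {c. s ''hit'' c \<noteq> 0} \<union> part v (Suc j)"
          unfolding dom using I p True by auto
        ultimately have "Q ?s" unfolding Q_def by blast
        then show ?thesis using True g s2 eqs * by (simp add: mark_body_def)
      next
        case False
        then have "?c \<in> {c. s ''hit'' c \<noteq> 0} \<union> part v j" using I by blast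
        then have "Q (update s2 ''j'' 0 (Suc j))"
          unfolding Q_def using I p True by (auto simp: marking_def)
        then show ?thesis using True False s2 eqs * by (simp add: mark_body_def)
      qed
    qed
    then show "runs b mark_body s2 60 (\<lambda>s'. ?I (Suc j) (update s' ''j'' 0 (Suc j)))"
      unfolding Q_def by (intro runs_wp b_pos) (simp add: mark_body_def)
  qed (use b_pos R_size assms marking_cong[OF assms(4)] in \<open>simp_all add: incidence_def\<close>)
qed

text \<open>One pass over the variables suffices because marks are never removed: a variable that
  was passed over keeps at most one unmarked clause, and a collected one has none. The program
  stores only the cardinality of \<open>S\<close>, hence the existential quantifier.\<close>

definition selected :: "nat \<Rightarrow> store \<Rightarrow> bool" where
  "selected v s \<longleftrightarrow> marking s \<and>
     (\<exists>S \<subseteq> {..<v}. {c. s ''hit'' c \<noteq> 0} = \<Union>(N ` S) \<and> s ''s'' 0 = card S \<and> 2 * card S \<le> s ''h'' 0) \<and>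
     (\<forall>u<v. card {c \<in> N u. s ''hit'' c = 0} \<le> 1)"

lemma runs_select:
  assumes "incidence R s" "s ''v'' 0 = v" "v < n" "selected v s"
  shows "runs b select s (300 * (length R + 1)) (selected (Suc v))"
proof -
  note [simp] = update_def
  have mk: "marking s" using assms(4) by (simp add: selected_def)
  obtain S where S: "S \<subseteq> {..<v}" "{c. s ''hit'' c \<noteq> 0} = \<Union>(N ` S)" "s ''s'' 0 = card S"
      "2 * card S \<le> s ''h'' 0"
    using assms(4) by (auto simp: selected_def)
  have fin: "finite S" using S(1) finite_subset by blast
  let ?new = "{c \<in> N v. s ''hit'' c = 0}"
  have "card ?new \<le> card {..<m}" using N_less[of v] by (intro card_mono) auto
  then have new: "card ?new \<le> m" by simp
  have "card S \<le> m" using S(4) marking_le(1)[OF mk] by simp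
  then have *: "0 < wbound b" "1 < wbound b" "card ?new < wbound b" "card S < wbound b" "card S + 1 < wbound b"
    using R_size new by linarith+
  have select_if: "runs b (If (Minus (V ''cnt'') (Num 1))
       (''s'' ::= Plus (V ''s'') (Num 1) ;; For ''j'' (V ''L'') mark_body) Skip) s1
       (4 + 1 + (10 + (length R + 1) * 100)) (selected (Suc v))"
    if cnt: "s1 ''cnt'' 0 = card ?new" and fr: "\<forall>a. a \<notin> {''cnt'', ''j''} \<longrightarrow> s1 a = s a" for s1
  proof -
    have eqs: "s1 ''hit'' = s ''hit''" "s1 ''h'' = s ''h''" "s1 ''s'' = s ''s''" "s1 ''v'' = s ''v''"
      "incidence R s1"
      using fr assms(1) by (auto simp: incidence_def)
    have "runs b (''s'' ::= Plus (V ''s'') (Num 1) ;; For ''j'' (V ''L'') mark_body) s1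
        (10 + (length R + 1) * 100) (selected (Suc v))" if ge2: "card ?new \<ge> 2"
    proof (rule runs_Seq[OF runs_wp[where Q = "\<lambda>s'. s' = update s1 ''s'' 0 (card S + 1)"]])
      fix s2 assume s2: "s2 = update s1 ''s'' 0 (card S + 1)"
      have "incidence R s2" "s2 ''v'' 0 = v" "marking s2"
        using s2 eqs assms mk by (auto simp: incidence_def marking_def)
      from runs_mark[OF this(1,2) assms(3) this(3)]
      show "runs b (For ''j'' (V ''L'') mark_body) s2 ((length R + 1) * 100) (selected (Suc v))"
      proof (rule runs_conseq)
        fix s3 assume s3: "marking s3 \<and> {c. s3 ''hit'' c \<noteq> 0} = {c. s2 ''hit'' c \<noteq> 0} \<union> N v"
          and fr3: "\<forall>a. a \<notin> writes (For ''j'' (V ''L'') mark_body) \<longrightarrow> s3 a = s2 a"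
        have hit3: "{c. s3 ''hit'' c \<noteq> 0} = {c. s ''hit'' c \<noteq> 0} \<union> N v"
          using s3 s2 eqs by simp
        have s3_s: "s3 ''s'' 0 = card S + 1" using fr3 s2 by simp
        have "v \<notin> S" using S(1) by auto
        then have card_ins: "card (insert v S) = card S + 1" using fin by simp
        \<comment> \<open>Restricting \<open>N v\<close> to its unmarked part makes the union
          disjoint, so \<open>h\<close> grows by \<open>card ?new\<close>, which is at least 2,
          while \<open>card S\<close> grows by 1.\<close>
        have "{c. s ''hit'' c \<noteq> 0} \<union> N v = {c. s ''hit'' c \<noteq> 0} \<union> ?new" by auto
        moreover have "finite {c. s ''hit'' c \<noteq> 0}"
          using mk by (auto simp: marking_def intro: finite_subset)
        ultimately have "card {c. s3 ''hit'' c \<noteq> 0} = card {c. s ''hit'' c \<noteq> 0} + card ?new"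
          unfolding hit3 by (simp add: card_Un_disjoint disjoint_iff)
        then have "s3 ''h'' 0 = s ''h'' 0 + card ?new"
          by (simp only: marking_card[OF mk] marking_card[OF conjunct1[OF s3]])
        then have "2 * card (insert v S) \<le> s3 ''h'' 0" using ge2 S(4) card_ins by simp
        moreover have "{c. s3 ''hit'' c \<noteq> 0} = \<Union>(N ` insert v S)" unfolding hit3 S(2) by auto
        moreover have "card {c \<in> N u. s3 ''hit'' c = 0} \<le> 1" if u: "u < Suc v" for u
        proof (cases "u = v")
          case True
          have "{c \<in> N v. s3 ''hit'' c = 0} = {}" using hit3 by blast
          then show ?thesis using True by (simp only: card.empty)
        next
          case False
          have "{c \<in> N u. s3 ''hit'' c = 0} \<subseteq> {c \<in> N u. s ''hit'' c = 0}" using hit3 by blast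
          then have "card {c \<in> N u. s3 ''hit'' c = 0} \<le> card {c \<in> N u. s ''hit'' c = 0}"
            by (intro card_mono) auto
          also have "\<dots> \<le> 1" using assms(4) u False by (simp add: selected_def)
          finally show ?thesis .
        qed
        ultimately show "selected (Suc v) s3" unfolding selected_def
          using s3 S(1) s3_s card_ins by (intro conjI exI[of _ "insert v S"]) auto
      qed simp
    qed (use b_pos eqs S * in auto)
    moreover have "selected (Suc v) s1" if "card ?new \<le> 1"
      unfolding selected_def
    proof (intro conjI)
      show "marking s1" using mk eqs marking_cong by blast
      show "\<exists>S\<subseteq>{..<Suc v}. {c. s1 ''hit'' c \<noteq> 0} = \<Union> (N ` S) \<and> s1 ''s'' 0 = card S \<and> 2 * card S \<le> s1 ''h'' 0"
        using S eqs by (intro exI[of _ S]) auto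
      show "\<forall>u<Suc v. card {c \<in> N u. s1 ''hit'' c = 0} \<le> 1"
        using assms(4) that eqs by (simp add: selected_def less_Suc_eq)
    qed
    then have "card ?new \<le> 1 \<Longrightarrow> runs b Skip s1 (10 + (length R + 1) * 100) (selected (Suc v))"
      by (intro runs_wp b_pos) auto
    ultimately have "runs b (If (Minus (V ''cnt'') (Num 1))
       (''s'' ::= Plus (V ''s'') (Num 1) ;; For ''j'' (V ''L'') mark_body) Skip) s1
       (nodes (Minus (V ''cnt'') (Num 1)) + 1 + (10 + (length R + 1) * 100)) (selected (Suc v))"
      using cnt * by (intro runs_If b_pos) auto
    then show ?thesis by simp
  qed
  have "runs b select s (3 + ((length R + 1) * 100 + (4 + 1 + (10 + (length R + 1) * 100)))) (selected (Suc v))"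
    unfolding select_def
  proof (rule runs_Seq[OF runs_wp[where Q = "\<lambda>s'. s' = update s ''cnt'' 0 0"] runs_Seq])
    fix s1 assume s1: "s1 = update s ''cnt'' 0 0"
    have "incidence R s1" "s1 ''v'' 0 = v" "marking s1" "s1 ''cnt'' 0 = 0"
      using s1 assms mk by (auto simp: incidence_def marking_def)
    from runs_count[OF this(1,2) assms(3) this(3,4)]
    show "runs b (For ''j'' (V ''L'') count_body) s1 ((length R + 1) * 100)
        (\<lambda>s'. s' ''cnt'' 0 = card ?new \<and> (\<forall>a. a \<notin> {''cnt'', ''j''} \<longrightarrow> s' a = s a))"
      by (rule runs_conseq) (use s1 in auto)
  next
    fix s1 s2 assume "s2 ''cnt'' 0 = card ?new \<and> (\<forall>a. a \<notin> {''cnt'', ''j''} \<longrightarrow> s2 a = s a)"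
    then show "runs b (If (Minus (V ''cnt'') (Num 1))
       (''s'' ::= Plus (V ''s'') (Num 1) ;; For ''j'' (V ''L'') mark_body) Skip) s2
       (4 + 1 + (10 + (length R + 1) * 100)) (selected (Suc v))"
      by (intro select_if) auto
  qed (use b_pos * in auto)
  then show ?thesis by (rule runs_conseq) auto
qed

lemma runs_greedy:
  assumes "incidence R s" "s ''in'' 1 = n" "\<forall>c. s ''hit'' c = 0" "s ''h'' 0 = 0" "s ''s'' 0 = 0"
  shows "runs b greedy s ((n + 1) * (400 * (length R + 1))) (selected n)"
  unfolding greedy_def
proof (rule runs_conseq[OF runs_For[where I = selected and T = "300 * (length R + 1)" and N = n]])
  fix v s2
  assume v: "v < n" "selected v s2" "s2 ''v'' 0 = v"
    and fr: "\<forall>a. a \<notin> insert ''v'' (writes select) \<longrightarrow> s2 a = s a"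
  have "incidence R s2" using fr assms(1) by (simp add: incidence_def)
  from runs_select[OF this v(3,1,2)]
  show "runs b select s2 (300 * (length R + 1)) (\<lambda>s'. selected (Suc v) (update s' ''v'' 0 (Suc v)))"
    by (rule runs_conseq) (auto simp: selected_def marking_def update_def)
next
  show "(n + 1) * (300 * (length R + 1) + nodes (Read ''in'' (Num 1)) + 13) \<le> (n + 1) * (400 * (length R + 1))"
    by (intro mult_le_mono) auto
qed (use b_pos R_size assms in \<open>auto simp: selected_def marking_def update_def bij_betw_def\<close>)

end

section \<open>Reading the input\<close>

text \<open>Only negative occurrences are recorded. Positive literals sit in the unit clauses of
  their variables, whose contribution is accounted for by comparing with n.\<close>

definition literal_body :: com where
  "literal_body =
     If (Read ''in'' (V ''p''))
       Skip
       (Assign ''cl'' (V ''L'') (V ''c'') ;;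
        Assign ''va'' (V ''L'') (Read ''in'' (Plus (V ''p'') (Num 1))) ;;
        ''L'' ::= Plus (V ''L'') (Num 1)) ;;
     ''p'' ::= Plus (V ''p'') (Num 2)"

definition clause_body :: com where
  "clause_body =
     ''len'' ::= Read ''in'' (V ''p'') ;;
     ''p'' ::= Plus (V ''p'') (Num 1) ;;
     For ''i'' (V ''len'') literal_body"

definition parse :: com where
  "parse = ''p'' ::= Num 3 ;; For ''c'' (Read ''in'' (Num 2)) clause_body"

lemma writes_parse [simp]:
  "writes literal_body = {''cl'', ''va'', ''L'', ''p''}"
  "writes clause_body = {''len'', ''cl'', ''va'', ''L'', ''p'', ''i''}"
  "writes parse = {''len'', ''cl'', ''va'', ''L'', ''p'', ''i'', ''c''}"
  by (auto simp: literal_body_def clause_body_def parse_def)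

section \<open>The list of negative occurrences\<close>

definition neg_occs :: "('v \<Rightarrow> nat) \<Rightarrow> nat \<Rightarrow> 'v literal list \<Rightarrow> (nat \<times> nat) list" where
  "neg_occs f i c = concat (map (\<lambda>l. case l of Pos x \<Rightarrow> [] | Neg x \<Rightarrow> [(i, f x)]) c)"

definition occs :: "('v \<Rightarrow> nat) \<Rightarrow> 'v literal list list \<Rightarrow> nat \<Rightarrow> (nat \<times> nat) list" where
  "occs f cs k = concat (map (\<lambda>i. neg_occs f i (cs ! i)) [0..<k])"

lemma set_neg_occs: "set (neg_occs f i c) = {(i, f x) | x. Neg x \<in> set c}"
  by (auto simp: neg_occs_def split: literal.splits)

lemma set_occs: "set (occs f cs k) = {(i, f x) | i x. i < k \<and> Neg x \<in> set (cs ! i)}"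
  by (auto simp: occs_def set_neg_occs)

lemma length_neg_occs: "length (neg_occs f i c) \<le> length c"
  by (induction c) (auto simp: neg_occs_def split: literal.splits)

lemma distinct_neg_occs:
  "distinct c \<Longrightarrow> inj_on f (var ` set c) \<Longrightarrow> distinct (neg_occs f i c)"
proof (induction c)
  case (Cons l c)
  then have "distinct (neg_occs f i c)" by (auto intro: inj_on_subset)
  moreover have "(i, f x) \<notin> set (neg_occs f i c)" if "l = Neg x" for x
  proof
    assume "(i, f x) \<in> set (neg_occs f i c)"
    then obtain y where y: "Neg y \<in> set c" "f x = f y" by (auto simp: set_neg_occs)
    have "x \<in> var ` set (l # c)" "y \<in> var ` set (l # c)" using that y(1) by force+
    then have "x = y" using inj_onD[OF Cons.prems(2) y(2)] by blast
    then show False using Cons.prems(1) y(1) that by simp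
  qed
  ultimately show ?case by (auto simp: neg_occs_def split: literal.splits)
qed (simp add: neg_occs_def)

lemma distinct_occs:
  assumes "\<And>i. i < k \<Longrightarrow> distinct (cs ! i) \<and> inj_on f (var ` set (cs ! i))"
  shows "distinct (occs f cs k)"
  using assms
proof (induction k)
  case (Suc k)
  then have "distinct (occs f cs k)" "distinct (neg_occs f k (cs ! k))"
    by (auto intro: distinct_neg_occs)
  then show ?case by (auto simp: occs_def set_neg_occs)
qed (simp add: occs_def)

lemma length_occs: "(\<And>i. i < k \<Longrightarrow> length (cs ! i) \<le> n) \<Longrightarrow> length (occs f cs k) \<le> k * n"
proof (induction k)
  case (Suc k)
  then have "length (occs f cs k) \<le> k * n" "length (neg_occs f k (cs ! k)) \<le> n"
    using length_neg_occs[of f k "cs ! k"] by (auto intro: le_trans)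
  then show ?case by (simp add: occs_def)
qed (simp add: occs_def)

lemma incidence_snoc:
  assumes "incidence R s" "s' ''L'' 0 = Suc (length R)"
    and "s' ''cl'' = (s ''cl'')(length R := i)" "s' ''va'' = (s ''va'')(length R := x)"
  shows "incidence (R @ [(i, x)]) s'"
  using assms by (simp add: incidence_def nth_append)

lemma drop_ConsD:
  assumes "drop p w = a # r"
  shows "p < length w" "w ! p = a" "drop (Suc p) w = r"
proof -
  show "p < length w" using assms by (rule_tac ccontr) simp
  then have "drop p w = w ! p # drop (Suc p) w" by (simp add: Cons_nth_drop_Suc)
  then show "w ! p = a" "drop (Suc p) w = r" using assms by simp_all
qed

locale tape =
  fixes b m n :: nat and w :: "nat list" and f :: "'v \<Rightarrow> nat" and cs :: "'v literal list list"
  assumes w_eq: "drop 3 w = concat (map (enc_clause f) cs)" "w ! 2 = m"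
    and len_cs: "length cs = m"
    and len_c: "\<And>i. i < m \<Longrightarrow> length (cs ! i) \<le> n"
    and w_size: "length w + m + n + 10 < wbound b" "\<forall>x\<in>set w. x < wbound b"
begin

lemma b_pos: "b > 0"
  using w_size by (cases b) (auto simp: wbound_def)

lemma in_less: "i < length w \<Longrightarrow> w ! i < wbound b"
  using w_size(2) by simp

lemma runs_literals:
  assumes s: "\<forall>i<length w. s ''in'' i = w ! i" "s ''c'' 0 = k" "k < m" "s ''len'' 0 = length c"
    and p: "drop (s ''p'' 0) w = concat (map (enc_literal f) c) @ rest"
    and R: "incidence R s" "length R \<le> s ''p'' 0" and c: "length c \<le> n"
  shows "runs b (For ''i'' (V ''len'') literal_body) s ((n + 1) * 100)
    (\<lambda>s'. drop (s' ''p'' 0) w = rest \<and> incidence (R @ neg_occs f k c) s' \<and>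
       length (R @ neg_occs f k c) \<le> s' ''p'' 0)"
proof -
  note [simp] = update_def
  \<comment> \<open>The unread part of the tape is described as a suffix of \<open>w\<close>. The
    last conjunct bounds the number of recorded pairs by the tape position, so the length of
    \<open>w\<close> also bounds \<open>L\<close>.\<close>
  let ?I = "\<lambda>q s'. drop (s' ''p'' 0) w = concat (map (enc_literal f) (drop q c)) @ rest \<and>
    incidence (R @ neg_occs f k (take q c)) s' \<and> length (R @ neg_occs f k (take q c)) \<le> s' ''p'' 0"
  show ?thesis
  proof (rule runs_conseq[OF runs_For[where I = ?I and T = 60 and N = "length c"]])
    fix q s2
    assume q: "q < length c" and I: "?I q s2" and s2: "s2 ''i'' 0 = q"
      and fr: "\<forall>a. a \<notin> insert ''i'' (writes literal_body) \<longrightarrow> s2 a = s a"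
    let ?p = "s2 ''p'' 0" and ?R = "R @ neg_occs f k (take q c)"
    have eqs: "s2 ''in'' = s ''in''" "s2 ''c'' 0 = k" "s2 ''L'' 0 = length ?R"
      using fr s I by (auto simp: incidence_def)
    have dropq: "drop q c = c ! q # drop (Suc q) c" using q by (simp add: Cons_nth_drop_Suc)
    obtain a x r where enc: "enc_literal f (c ! q) = [a, x]" by (cases "c ! q") auto
    have "drop ?p w = a # x # concat (map (enc_literal f) (drop (Suc q) c)) @ rest"
      using I unfolding dropq by (simp add: enc)
    note p1 = drop_ConsD[OF this]
    note p2 = drop_ConsD[OF p1(3)]
    have ax: "s2 ''in'' ?p = a" "s2 ''in'' (Suc ?p) = x" using p1 p2 eqs(1) s(1) by auto
    have small: "a < wbound b" "x < wbound b" using in_less p1(1,2) p2(1,2) by metis+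
    have len: "length ?R \<le> ?p" using I by simp
    have *: "0 < wbound b" "1 < wbound b" "2 < wbound b" "?p < wbound b" "?p + 1 < wbound b" "?p + 2 < wbound b"
      "k < wbound b" "length ?R < wbound b" "length ?R + 1 < wbound b"
      using w_size(1) p2(1) len s(3) by linarith+
    define Q where "Q = ?I (Suc q)"
    have take: "take (Suc q) c = take q c @ [c ! q]" using q by (rule take_Suc_conv_app_nth)
    have "wp (wbound b) literal_body (\<lambda>s'. Q (update s' ''i'' 0 (Suc q))) s2"
    proof (cases "c ! q")
      case (Pos y)
      then have "neg_occs f k (take (Suc q) c) = neg_occs f k (take q c)"
        unfolding take by (simp add: neg_occs_def)
      then have "Q (update (update s2 ''p'' 0 (?p + 2)) ''i'' 0 (Suc q))"
        unfolding Q_def using I p2(3) len by (auto simp: incidence_def)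
      then show ?thesis using s2 eqs * ax small Pos enc by (simp add: literal_body_def)
    next
      case (Neg y)
      then have R': "R @ neg_occs f k (take (Suc q) c) = ?R @ [(k, x)]"
        unfolding take using enc by (simp add: neg_occs_def)
      let ?s = "update (update (update (update (update s2 ''cl'' (length ?R) k) ''va'' (length ?R) x)
        ''L'' 0 (length ?R + 1)) ''p'' 0 (?p + 2)) ''i'' 0 (Suc q)"
      have "incidence (?R @ [(k, x)]) ?s"
        using I by (intro incidence_snoc[of ?R s2]) auto
      then have "Q ?s"
        unfolding Q_def R' using p2(3) len by auto
      then show ?thesis using s2 eqs * ax small Neg enc by (simp add: literal_body_def)
    qed
    then show "runs b literal_body s2 60 (\<lambda>s'. ?I (Suc q) (update s' ''i'' 0 (Suc q)))"
      unfolding Q_def by (intro runs_wp b_pos) (simp add: literal_body_def)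
  next
    show "(length c + 1) * (60 + nodes (V ''len'') + 13) \<le> (n + 1) * 100"
      using c by (intro mult_le_mono) auto
  qed (use b_pos w_size c s R p in \<open>auto simp: incidence_def neg_occs_def\<close>)
qed

lemma runs_parse:
  assumes s: "\<forall>i<length w. s ''in'' i = w ! i" "length w \<ge> 3" "s ''L'' 0 = 0"
  shows "runs b parse s (200 * ((m + 1) * (n + 1))) (incidence (occs f cs m))"
proof -
  note [simp] = update_def
  let ?I = "\<lambda>k s'. drop (s' ''p'' 0) w = concat (map (enc_clause f) (drop k cs)) \<and>
    incidence (occs f cs k) s' \<and> length (occs f cs k) \<le> s' ''p'' 0"
  have clause: "runs b clause_body s2 ((n + 1) * 120) (?I (Suc k))"
    if k: "k < m" and I: "?I k s2" and s2: "s2 ''c'' 0 = k" "s2 ''in'' = s ''in''" for k s2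
  proof -
    let ?p = "s2 ''p'' 0" and ?c = "cs ! k" and ?rest = "concat (map (enc_clause f) (drop (Suc k) cs))"
    have "drop k cs = ?c # drop (Suc k) cs" using k len_cs by (simp add: Cons_nth_drop_Suc)
    then have "drop ?p w = length ?c # concat (map (enc_literal f) ?c) @ ?rest"
      using I by (simp add: enc_clause_def)
    note p1 = drop_ConsD[OF this]
    have len: "s2 ''in'' ?p = length ?c" using p1 s(1) s2(2) by simp
    have *: "0 < wbound b" "1 < wbound b" "?p < wbound b" "?p + 1 < wbound b" "length ?c < wbound b"
      using w_size(1) p1(1) len_c[OF k] by linarith+
    have "runs b clause_body s2 (20 + (n + 1) * 100) (?I (Suc k))"
      unfolding clause_body_def
    proof (rule runs_conseq[OF runs_Seq[OF runs_wp[where T = 5 and Q = "\<lambda>s'. s' = update s2 ''len'' 0 (length ?c)"]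
          runs_Seq[OF runs_wp[where T = 10 and Q = "\<lambda>s'. s' = update (update s2 ''len'' 0 (length ?c)) ''p'' 0 (Suc ?p)"]]]])
      fix s3 assume s3: "s3 = update (update s2 ''len'' 0 (length ?c)) ''p'' 0 (Suc ?p)"
      show "runs b (For ''i'' (V ''len'') literal_body) s3 ((n + 1) * 100) (?I (Suc k))"
      proof (rule runs_conseq[OF runs_literals[where c = ?c and k = k and R = "occs f cs k" and rest = ?rest]])
        fix s' assume "drop (s' ''p'' 0) w = ?rest \<and> incidence (occs f cs k @ neg_occs f k ?c) s' \<and>
          length (occs f cs k @ neg_occs f k ?c) \<le> s' ''p'' 0"
        moreover have "occs f cs k @ neg_occs f k ?c = occs f cs (Suc k)" by (simp add: occs_def)
        ultimately show "?I (Suc k) s'" by simp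
      qed (use s s2 s3 I k p1(3) len_c[OF k] in \<open>auto simp: incidence_def\<close>)
    qed (use b_pos * len in auto)
    then show ?thesis by (rule runs_conseq) auto
  qed
  have "runs b parse s (3 + (m + 1) * ((n + 1) * 120 + 2 + 13)) (?I m)"
    unfolding parse_def
  proof (rule runs_Seq[OF runs_wp[where Q = "\<lambda>s'. s' = update s ''p'' 0 3"]])
    fix s1 assume s1: "s1 = update s ''p'' 0 3"
    show "runs b (For ''c'' (Read ''in'' (Num 2)) clause_body) s1 ((m + 1) * ((n + 1) * 120 + 2 + 13)) (?I m)"
    proof (rule runs_conseq[OF runs_For[where I = ?I and T = "(n + 1) * 120" and N = m]])
      fix k s2
      assume k: "k < m" "?I k s2" "s2 ''c'' 0 = k"
        and fr: "\<forall>a. a \<notin> insert ''c'' (writes clause_body) \<longrightarrow> s2 a = s1 a"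
      then have "s2 ''in'' = s ''in''" using s1 by simp
      from clause[OF k this]
      show "runs b clause_body s2 ((n + 1) * 120) (\<lambda>s'. ?I (Suc k) (update s' ''c'' 0 (Suc k)))"
        by (rule runs_conseq) (auto simp: incidence_def)
    qed (use b_pos w_size w_eq s s1 in \<open>auto simp: occs_def incidence_def\<close>)
  qed (use b_pos w_size in auto)
  then show ?thesis
  proof (rule runs_conseq)
    have "(m + 1) * ((n + 1) * 120 + 2 + 13) \<le> (m + 1) * ((n + 1) * 135)"
      by (intro mult_le_mono) auto
    then show "3 + (m + 1) * ((n + 1) * 120 + 2 + 13) \<le> 200 * ((m + 1) * (n + 1))"
      by (simp add: algebra_simps)
  qed simp
qed

end

section \<open>Satisfied clauses as hitting sets\<close>

lemma size_filter_mset_map: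
  "size {#c \<in># mset (map g cs). P c#} = card {i. i < length cs \<and> P (g (cs ! i))}"
proof -
  have "size {#c \<in># mset (map g cs). P c#} = length (filter P (map g cs))"
    by (simp flip: mset_filter del: mset_map)
  also have "\<dots> = card {i. i < length cs \<and> P (g (cs ! i))}"
    unfolding length_filter_conv_card by (intro arg_cong[where f = card]) auto
  finally show ?thesis .
qed

lemma finite_vars: "is_cnf F \<Longrightarrow> finite (vars F)"
  by (auto simp: is_cnf_def vars_def vars_clause_def)

lemma sat_ge_iff: "x \<le> sat F \<longleftrightarrow> (\<exists>\<tau>. x \<le> size {#c \<in># F. satisfies \<tau> c#})"
proof -
  have "range (\<lambda>\<tau>. size {#c \<in># F. satisfies \<tau> c#}) \<subseteq> {..size F}"
    by (auto intro: size_mset_mono)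
  then have "finite (range (\<lambda>\<tau>. size {#c \<in># F. satisfies \<tau> c#}))"
    by (rule finite_subset) simp
  then show ?thesis unfolding sat_def by (subst Max_ge_iff) auto
qed

lemma sat_le_size: "sat F \<le> size F"
proof -
  obtain \<tau> where "sat F \<le> size {#c \<in># F. satisfies \<tau> c#}" using sat_ge_iff by blast
  also have "\<dots> \<le> size F" by (rule size_mset_mono) simp
  finally show ?thesis .
qed

text \<open>Every edge contains a variable, and disjoint edges contain different ones, so a matching
  injects into the variables.\<close>

lemma nu_le_card_vars:
  assumes "is_cnf F"
  shows "\<nu> F \<le> card (vars F)"
proof -
  have le: "card M \<le> card (vars F)" if M: "matching (B_edges F) M" for M
  proof -
    define g where "g e = (SOME v. Inl v \<in> e \<and> v \<in> vars F)" for e :: "('a + 'a clause \<times> nat) set"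
    have g: "Inl (g e) \<in> e \<and> g e \<in> vars F" if "e \<in> M" for e
    proof -
      have "e \<in> B_edges F" using M that by (auto simp: matching_def)
      then obtain v c i where "e = {Inl v, Inr (c, i)}" "i < count F c" "v \<in> vars_clause c"
        unfolding B_edges_def mem_Collect_eq by metis
      moreover from this have "c \<in># F" by (metis count_greater_zero_iff gr_implies_not0 neq0_conv)
      ultimately have "Inl v \<in> e \<and> v \<in> vars F" unfolding vars_def by blast
      then show ?thesis unfolding g_def by (rule someI)
    qed
    have "inj_on g M"
    proof (rule inj_onI)
      fix e e' assume "e \<in> M" "e' \<in> M" "g e = g e'"
      then have "\<not> disjnt e e'" using g[of e] g[of e'] by (auto simp: disjnt_iff)
      then show "e = e'" using M \<open>e \<in> M\<close> \<open>e' \<in> M\<close> by (auto simp: matching_def pairwise_def)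
    qed
    then show ?thesis using g finite_vars[OF assms] by (intro card_inj_on_le) auto
  qed
  have "card ` {M. matching (B_edges F) M} \<subseteq> {..card (vars F)}" using le by auto
  then have "finite (card ` {M. matching (B_edges F) M})" by (rule finite_subset) simp
  moreover have "matching (B_edges F) {}" by (simp add: matching_def)
  ultimately show ?thesis unfolding \<nu>_def using le by (subst Max_le_iff) auto
qed

locale special_instance =
  fixes F :: "'v formula" and \<alpha> :: nat and f :: "'v \<Rightarrow> nat" and cs :: "'v literal list list" and m n :: nat
  assumes special: "transformed_special_instance F \<alpha>"
    and f_bij: "bij_betw f (vars F) {..<n}"
    and cs_distinct: "\<And>i. i < m \<Longrightarrow> distinct (cs ! i)"
    and cs_F: "mset (map set cs) = F"
    and n_def: "n = card (vars F)"
    and m_def: "m = size F"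
begin

abbreviation R where "R \<equiv> occs f cs m"

lemma cnf: "is_cnf F"
  using special by (simp add: transformed_special_instance_def)

lemma length_cs: "length cs = m"
  using cs_F m_def by (metis length_map size_mset)

lemma size_filter: "size {#c \<in># F. P c#} = card {i. i < m \<and> P (set (cs ! i))}"
  using size_filter_mset_map[of P set cs] unfolding cs_F length_cs .

lemma cs_in_F: "i < m \<Longrightarrow> set (cs ! i) \<in># F"
  using length_cs by (auto simp flip: cs_F)

lemma var_in_vars: "i < m \<Longrightarrow> l \<in> set (cs ! i) \<Longrightarrow> var l \<in> vars F"
  using cs_in_F[of i] by (auto simp: vars_def vars_clause_def intro!: bexI[of _ "set (cs ! i)"])

lemma f_less: "x \<in> vars F \<Longrightarrow> f x < n"
  using f_bij by (auto simp: bij_betw_def)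

lemma f_inj: "x \<in> vars F \<Longrightarrow> y \<in> vars F \<Longrightarrow> f x = f y \<Longrightarrow> x = y"
  using f_bij by (auto simp: bij_betw_def inj_on_def)

lemma positive_unit: "i < m \<Longrightarrow> Pos x \<in> set (cs ! i) \<Longrightarrow> set (cs ! i) = {Pos x}"
  using special cs_in_F[of i] var_in_vars[of i "Pos x"] by (auto simp: transformed_special_instance_def)

lemma positive_once: "x \<in> vars F \<Longrightarrow> card {i. i < m \<and> Pos x \<in> set (cs ! i)} = 1"
  using special size_filter[of "\<lambda>c. Pos x \<in> c"]
  by (simp add: transformed_special_instance_def occ_def)

lemma in_clauses_of: "c \<in> clauses_of R v \<longleftrightarrow> c < m \<and> (\<exists>x. Neg x \<in> set (cs ! c) \<and> v = f x)"
  by (auto simp: clauses_of_def set_occs)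

lemma length_clause: "i < m \<Longrightarrow> length (cs ! i) \<le> n"
proof -
  assume i: "i < m"
  have "inj_on var (set (cs ! i))"
  proof (rule inj_onI)
    fix l l' assume l: "l \<in> set (cs ! i)" "l' \<in> set (cs ! i)" "var l = var l'"
    have "\<not> (Pos x \<in> set (cs ! i) \<and> Neg x \<in> set (cs ! i))" for x
      using cnf cs_in_F[OF i] unfolding is_cnf_def by metis
    from this[of "var l"] l show "l = l'" by (cases l; cases l') auto
  qed
  then have "card (set (cs ! i)) \<le> card (vars F)"
    using var_in_vars[OF i] finite_vars[OF cnf] by (intro card_inj_on_le[of var]) auto
  then show ?thesis using distinct_card[OF cs_distinct[OF i]] n_def by simp
qed

text \<open>Satisfied clauses are of two kinds: the unit clauses of the true variables, one for
  each, and the clauses hit by a negated false variable. They are disjoint because a clause with a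
  positive literal has no other literal. The additive form avoids truncated subtraction.\<close>

lemma size_satisfied:
  fixes \<tau> :: "'v \<Rightarrow> bool"
  defines "S \<equiv> f ` {x \<in> vars F. \<not> \<tau> x}"
  shows "size {#c \<in># F. satisfies \<tau> c#} + card S = n + card (\<Union>(clauses_of R ` S))"
proof -
  let ?P = "\<lambda>x. {i. i < m \<and> Pos x \<in> set (cs ! i)}"
  let ?T = "{x \<in> vars F. \<tau> x}"
  have fin: "finite (vars F)" by (rule finite_vars[OF cnf])
  have "{i. i < m \<and> satisfies \<tau> (set (cs ! i))} = (\<Union>x\<in>?T. ?P x) \<union> \<Union>(clauses_of R ` S)"
  proof (intro set_eqI iffI)
    fix i assume "i \<in> {i. i < m \<and> satisfies \<tau> (set (cs ! i))}"
    then obtain l where i: "i < m" and l: "l \<in> set (cs ! i)" "lit_true \<tau> l"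
      by (auto simp: satisfies_def)
    show "i \<in> (\<Union>x\<in>?T. ?P x) \<union> \<Union>(clauses_of R ` S)"
      using i l var_in_vars[OF i l(1)] by (cases l) (auto simp: in_clauses_of S_def)
  next
    fix i assume "i \<in> (\<Union>x\<in>?T. ?P x) \<union> \<Union>(clauses_of R ` S)"
    then show "i \<in> {i. i < m \<and> satisfies \<tau> (set (cs ! i))}"
    proof
      assume "i \<in> (\<Union>x\<in>?T. ?P x)"
      then show ?thesis by (auto simp: satisfies_def intro: bexI[rotated])
    next
      assume "i \<in> \<Union>(clauses_of R ` S)"
      then obtain x y where xy: "i < m" "Neg x \<in> set (cs ! i)" "y \<in> vars F" "\<not> \<tau> y" "f y = f x"
        by (auto simp: in_clauses_of S_def)
      then have "x = y" using f_inj[of x y] var_in_vars[of i "Neg x"] by auto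
      then show ?thesis using xy by (auto simp: satisfies_def intro!: bexI[of _ "Neg x"])
    qed
  qed
  moreover have "(\<Union>x\<in>?T. ?P x) \<inter> \<Union>(clauses_of R ` S) = {}"
    using positive_unit by (fastforce simp: in_clauses_of)
  moreover have "finite (\<Union>x\<in>?T. ?P x)" by (rule finite_subset[of _ "{..<m}"]) auto
  moreover have "finite (\<Union>(clauses_of R ` S))"
    by (rule finite_subset[of _ "{..<m}"]) (auto simp: in_clauses_of)
  moreover have "card (\<Union>x\<in>?T. ?P x) = card ?T"
  proof -
    have "?P x \<inter> ?P y = {}" if "x \<noteq> y" for x y
      using positive_unit[of _ x] that by fastforce
    then have "card (\<Union>x\<in>?T. ?P x) = (\<Sum>x\<in>?T. card (?P x))"
      using fin by (intro card_UN_disjoint) auto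
    then show ?thesis using positive_once by simp
  qed
  ultimately have "size {#c \<in># F. satisfies \<tau> c#} = card ?T + card (\<Union>(clauses_of R ` S))"
    unfolding size_filter by (simp add: card_Un_disjoint)
  moreover have "card S = card {x \<in> vars F. \<not> \<tau> x}"
    unfolding S_def using f_inj by (intro card_image) (auto simp: inj_on_def)
  moreover have "card ?T + card {x \<in> vars F. \<not> \<tau> x} = n"
  proof -
    have "?T \<inter> {x \<in> vars F. \<not> \<tau> x} = {}" by auto
    then have "card (?T \<union> {x \<in> vars F. \<not> \<tau> x}) = card ?T + card {x \<in> vars F. \<not> \<tau> x}"
      using fin by (intro card_Un_disjoint) auto
    moreover have "?T \<union> {x \<in> vars F. \<not> \<tau> x} = vars F" by auto
    ultimately show ?thesis using n_def by simp
  qed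
  ultimately show ?thesis by simp
qed

text \<open>As \<open>f\<close> is a bijection, the sets of numbers of false variables are exactly
  the subsets of \<open>{..<n}\<close>. An optimum with exact difference, from
  \<open>opt_attained\<close>, gives back the untruncated inequality.\<close>

lemma sat_iff_opt: "n + k \<le> sat F \<longleftrightarrow> k \<le> opt (clauses_of R) {..<n} {..<m}"
proof -
  let ?H = "\<lambda>S. \<Union>(clauses_of R ` S)"
  have sub: "{..<m} \<inter> ?H S = ?H S" for S by (auto simp: in_clauses_of)
  have "n + k \<le> sat F \<longleftrightarrow> (\<exists>\<tau>. let S = f ` {x \<in> vars F. \<not> \<tau> x} in k + card S \<le> card (?H S))"
    unfolding sat_ge_iff Let_def
  proof (intro arg_cong[where f = Ex] ext)
    fix \<tau>
    show "(n + k \<le> size {#c \<in># F. satisfies \<tau> c#}) =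
        (k + card (f ` {x \<in> vars F. \<not> \<tau> x}) \<le> card (?H (f ` {x \<in> vars F. \<not> \<tau> x})))"
      using size_satisfied[of \<tau>] by linarith
  qed
  also have "\<dots> \<longleftrightarrow> (\<exists>S \<subseteq> {..<n}. k + card S \<le> card (?H S))"
  proof (intro iffI)
    assume "\<exists>\<tau>. let S = f ` {x \<in> vars F. \<not> \<tau> x} in k + card S \<le> card (?H S)"
    then obtain \<tau> where "k + card (f ` {x \<in> vars F. \<not> \<tau> x}) \<le> card (?H (f ` {x \<in> vars F. \<not> \<tau> x}))"
      by (auto simp: Let_def)
    then show "\<exists>S \<subseteq> {..<n}. k + card S \<le> card (?H S)"
      using f_less by (intro exI[of _ "f ` {x \<in> vars F. \<not> \<tau> x}"]) auto
  next
    assume "\<exists>S \<subseteq> {..<n}. k + card S \<le> card (?H S)"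
    then obtain S where S: "S \<subseteq> {..<n}" "k + card S \<le> card (?H S)" by blast
    have "f ` {x \<in> vars F. \<not> f x \<notin> S} = S"
      using f_bij S(1) by (auto simp: bij_betw_def image_iff)
    then show "\<exists>\<tau>. let S = f ` {x \<in> vars F. \<not> \<tau> x} in k + card S \<le> card (?H S)"
      using S(2) by (intro exI[of _ "\<lambda>x. f x \<notin> S"]) (simp add: Let_def)
  qed
  also have "\<dots> \<longleftrightarrow> k \<le> opt (clauses_of R) {..<n} {..<m}"
  proof
    assume "\<exists>S \<subseteq> {..<n}. k + card S \<le> card (?H S)"
    then obtain S where S: "S \<subseteq> {..<n}" "k + card S \<le> card (?H S)" by blast
    then show "k \<le> opt (clauses_of R) {..<n} {..<m}"
      using opt_ge[of "{..<n}" S "{..<m}" "clauses_of R"] sub[of S] by simp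
  next
    assume k: "k \<le> opt (clauses_of R) {..<n} {..<m}"
    obtain S where "S \<subseteq> {..<n}" "opt (clauses_of R) {..<n} {..<m} = card ({..<m} \<inter> ?H S) - card S"
        "card S \<le> card ({..<m} \<inter> ?H S)"
      by (rule opt_attained[of "{..<n}" "clauses_of R" "{..<m}"]) auto
    then show "\<exists>S \<subseteq> {..<n}. k + card S \<le> card (?H S)"
      using k sub[of S] by (intro exI[of _ S]) auto
  qed
  finally show ?thesis .
qed

lemma occurrences:
  assumes "m * n + 3 * m + n + 10 < wbound b"
  shows "occurrences b m n R"
proof
  show "c < m \<and> v < n" if "(c, v) \<in> set R" for c v
    using that f_less var_in_vars[of c] by (force simp: set_occs)
  show "distinct R"
  proof (rule distinct_occs)
    fix i assume i: "i < m"
    have "var ` set (cs ! i) \<subseteq> vars F" using var_in_vars[OF i] by auto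
    then show "distinct (cs ! i) \<and> inj_on f (var ` set (cs ! i))"
      using cs_distinct[OF i] f_bij by (auto simp: bij_betw_def intro: inj_on_subset)
  qed
  show "length R + 3 * m + n + 10 < wbound b"
    using assms length_occs[of m cs n f] length_clause by simp
qed

end

section \<open>The complete algorithm\<close>

definition finish :: com where
  "finish =
     If (Minus (Minus (Read ''in'' (Num 0)) (Read ''in'' (Num 1)))
          (Read ''D'' (Minus (Read ''pw'' (Plus (V ''h'') (Num 1))) (Num 1))))
       (''out'' ::= Num 0)
       (''out'' ::= Num 1)"

text \<open>Nonzero exactly when \<open>h < s + (\<alpha> - n)\<close>, that is, when the collected
  variables alone do not establish the answer yes.\<close>

definition unpaid :: aexp where
  "unpaid = Minus (Plus (V ''s'') (Minus (Read ''in'' (Num 0)) (Read ''in'' (Num 1)))) (V ''h'')"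

definition search :: com where
  "search = If unpaid (dynamic ;; finish) (''out'' ::= Num 1)"

text \<open>For \<open>\<alpha> \<le> n\<close> the all-true assignment suffices, and
  \<open>\<alpha> > m\<close> is impossible to reach. Past these two tests \<alpha> is at most the
  number of clauses, so a bound \<open>b\<close> in terms of m and n exists for all values.\<close>

definition solver :: com where
  "solver =
     If (Minus (Read ''in'' (Num 0)) (Read ''in'' (Num 1)))
       (If (Minus (Read ''in'' (Num 0)) (Read ''in'' (Num 2)))
         (''out'' ::= Num 0)
         (parse ;; greedy ;; search))
       (''out'' ::= Num 1)"

lemma writes_dynamic [simp]:
  "writes dynamic = {''pw'', ''i'', ''e'', ''v'', ''nb'', ''o'', ''j'', ''q'', ''ct'', ''x'', ''y'', ''D''}"
  by (auto simp: dynamic_def)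

lemma runs_search:
  fixes R :: "(nat \<times> nat) list"
  assumes occ: "occurrences b m n R" and big: "2 ^ (m + 1) < wbound b" "\<alpha> < wbound b"
    and inp: "incidence R s" "s ''in'' 0 = \<alpha>" "s ''in'' 1 = n" "s ''in'' 2 = m"
    and zero: "\<forall>c. s ''hit'' c = 0" "s ''h'' 0 = 0" "s ''s'' 0 = 0" "\<forall>x. s ''D'' x = 0"
    and \<alpha>: "n < \<alpha>" "\<alpha> \<le> m"
  shows "runs b (greedy ;; search) s
     ((n + 1) * (400 * (length R + 1)) +
      (50 + 1500 * ((m + 2) * (n + 1) * ((m + length R + 3) * (2 * 4 ^ (\<alpha> - n))))))
     (\<lambda>s'. s' ''out'' 0 \<noteq> 0 \<longleftrightarrow> \<alpha> - n \<le> opt (clauses_of R) {..<n} {..<m})"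
    (is "runs b _ s (_ + (50 + ?T)) ?Q")
proof -
  note [simp] = update_def
  interpret occurrences b m n R by (rule occ)
  show ?thesis
  proof (rule runs_Seq[OF runs_greedy[OF inp(1,3) zero(1-3)]])
    fix s1
    assume sel: "selected n s1" and fr: "\<forall>a. a \<notin> writes greedy \<longrightarrow> s1 a = s a"
    have mk: "marking s1" using sel by (simp add: selected_def)
    obtain S where S: "S \<subseteq> {..<n}" "{c. s1 ''hit'' c \<noteq> 0} = \<Union>(N ` S)" "s1 ''s'' 0 = card S"
        "2 * card S \<le> s1 ''h'' 0"
      using sel by (auto simp: selected_def)
    have eqs: "incidence R s1" "s1 ''in'' 0 = \<alpha>" "s1 ''in'' 1 = n" "s1 ''in'' 2 = m" "\<forall>x. s1 ''D'' x = 0"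
      using fr inp zero by (auto simp: incidence_def)
    let ?h = "s1 ''h'' 0"
    have h_le: "?h \<le> m" by (rule marking_le(1)[OF mk])
    then have sizes: "0 < wbound b" "1 < wbound b" "2 < wbound b" "?h + 1 < wbound b" "card S + (\<alpha> - n) < wbound b"
      "n < wbound b" "m < wbound b" "card S < wbound b"
      using R_size S(4) \<alpha> by linarith+
    have "runs b search s1 (nodes unpaid + 1 + (?T + 30)) ?Q"
      unfolding search_def
    proof (rule runs_If[OF b_pos])
      show "fits (wbound b) unpaid s1"
        using eqs S sizes big by (simp add: unpaid_def)
    next
      assume "aval unpaid s1 = 0"
      then have "card S + (\<alpha> - n) \<le> ?h" using eqs S by (simp add: unpaid_def)
      moreover have "{..<m} \<inter> \<Union>(N ` S) = \<Union>(N ` S)" using N_less by blast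
      then have "?h - card S \<le> opt N {..<n} {..<m}"
        using opt_ge[OF _ S(1), of "{..<m}" N] marking_card[OF mk] S(2) by simp
      ultimately have "\<alpha> - n \<le> opt N {..<n} {..<m}" by linarith
      then show "runs b (''out'' ::= Num 1) s1 (?T + 30) ?Q"
        using sizes by (intro runs_wp b_pos) simp_all
    next
      assume "aval unpaid s1 \<noteq> 0"
      then have "?h < card S + (\<alpha> - n)" using eqs S by (simp add: unpaid_def)
      \<comment> \<open>Doubling \<open>h < s + (\<alpha> - n)\<close> and using
        \<open>2 * s \<le> h\<close> gives \<open>h < 2 * (\<alpha> - n)\<close>. Strictness leaves
        room for the bit of the current group.\<close>
      then have h2: "?h + 1 \<le> 2 * (\<alpha> - n)" using S(4) by linarith
      have pow: "(2::nat) ^ (?h + 1) \<le> 2 ^ (m + 1)" using h_le by (intro power_increasing) auto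
      \<comment> \<open>The array \<open>hit\<close> left by the greedy phase is the numbering of
        the marked clauses.\<close>
      interpret M: machine m n ?h R "s1 ''hit''" b
      proof
        show "bij_betw (s1 ''hit'') {c. s1 ''hit'' c \<noteq> 0} {1..?h}" using mk by (simp only: marking_def)
        show "card {c \<in> N v. s1 ''hit'' c = 0} \<le> 1" if "v < n" for v using sel that by (simp add: selected_def)
        show "2 ^ (?h + 1) < wbound b" using pow big by linarith
      qed (use N_less R_less R_size h_le in auto)
      have input: "M.input s1" using eqs by (simp add: M.input_def)
      have "runs b (dynamic ;; finish) s1
         (1500 * ((m + 2) * (n + 1) * ((?h + length R + 3) * (2 ^ (?h + 1) + 1))) + 30) ?Q"
      proof (rule runs_Seq[OF M.runs_dynamic[OF input eqs(5)]])
        fix s2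
        assume s2: "s2 ''pw'' (?h + 1) = 2 ^ (?h + 1) \<and> s2 ''D'' (2 ^ (?h + 1) - 1) = opt N {..<n} {..<m}"
          and fr2: "\<forall>a. a \<notin> writes dynamic \<longrightarrow> s2 a = s1 a"
        have eqs2: "s2 ''in'' 0 = \<alpha>" "s2 ''in'' (Suc 0) = n" "s2 ''h'' 0 = ?h" using fr2 eqs by auto
        have opt: "opt N {..<n} {..<m} \<le> m" using opt_le_card[of "{..<n}" "{..<m}" N] by simp
        then have "opt N {..<n} {..<m} < wbound b" "2 ^ (?h + 1) < wbound b"
          using sizes pow big by linarith+
        then show "runs b finish s2 30 ?Q"
          using s2 eqs2 sizes big by (intro runs_wp b_pos) (auto simp: finish_def)
      qed
      then show "runs b (dynamic ;; finish) s1 (?T + 30) ?Q"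
      proof (rule runs_conseq)
        have "(2::nat) ^ (?h + 1) \<le> 2 ^ (2 * (\<alpha> - n))" using h2 by (intro power_increasing) auto
        moreover have "(2::nat) ^ (2 * (\<alpha> - n)) = 4 ^ (\<alpha> - n)" by (simp add: power_mult)
        moreover have "1 \<le> (4::nat) ^ (\<alpha> - n)" by simp
        ultimately have "(2::nat) ^ (?h + 1) + 1 \<le> 2 * 4 ^ (\<alpha> - n)" by linarith
        then show "1500 * ((m + 2) * (n + 1) * ((?h + length R + 3) * (2 ^ (?h + 1) + 1))) + 30 \<le> ?T + 30"
          using h_le by (intro add_right_mono mult_le_mono) auto
      qed
    qed
    then show "runs b search s1 (50 + ?T) ?Q" by (rule runs_conseq) (simp_all add: unpaid_def)
  qed
qed

lemma (in tape) runs_solver: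
  assumes occ: "occurrences b m n (occs f cs m)" and big: "2 ^ (m + 1) < wbound b"
    and w: "length w \<ge> 3" "w ! 0 = \<alpha>" "w ! 1 = n" and \<alpha>: "n < \<alpha>" "\<alpha> \<le> m"
  shows "runs b solver (init_store w)
    (12 + (200 * ((m + 1) * (n + 1)) + ((n + 1) * (400 * (length (occs f cs m) + 1)) +
      (50 + 1500 * ((m + 2) * (n + 1) * ((m + length (occs f cs m) + 3) * (2 * 4 ^ (\<alpha> - n))))))))
    (\<lambda>s'. s' ''out'' 0 \<noteq> 0 \<longleftrightarrow> \<alpha> - n \<le> opt (clauses_of (occs f cs m)) {..<n} {..<m})"
    (is "runs b solver ?s (12 + ?T) ?Q")
proof -
  let ?in = "\<lambda>i. Read ''in'' (Num i)"
  have init: "\<forall>i<length w. ?s ''in'' i = w ! i" "?s ''in'' 0 = \<alpha>" "?s ''in'' 1 = n" "?s ''in'' (Suc 0) = n" "?s ''in'' 2 = m"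
    "\<And>a i. a \<noteq> ''in'' \<Longrightarrow> ?s a i = 0"
    using w w_eq by (auto simp: init_store_def)
  have sizes: "0 < wbound b" "1 < wbound b" "2 < wbound b" "\<alpha> < wbound b" "n < wbound b" "m < wbound b"
    using w_size(1) \<alpha> by linarith+
  have "runs b solver ?s (nodes (Minus (?in 0) (?in 1)) + 1 + (nodes (Minus (?in 0) (?in 2)) + 1 + ?T)) ?Q"
    unfolding solver_def
  proof (intro runs_If[OF b_pos])
    assume "aval (Minus (?in 0) (?in 1)) ?s = 0"
    then show "runs b (''out'' ::= Num 1) ?s (nodes (Minus (?in 0) (?in 2)) + 1 + ?T) ?Q"
      using init \<alpha> by simp
  next
    assume "aval (Minus (?in 0) (?in 2)) ?s \<noteq> 0"
    then show "runs b (''out'' ::= Num 0) ?s ?T ?Q"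
      using init \<alpha> by simp
  next
    show "runs b (parse ;; greedy ;; search) ?s ?T ?Q"
    proof (rule runs_Seq[OF runs_parse])
      fix s1 assume "incidence (occs f cs m) s1" "\<forall>a. a \<notin> writes parse \<longrightarrow> s1 a = ?s a"
      then show "runs b (greedy ;; search) s1
         ((n + 1) * (400 * (length (occs f cs m) + 1)) +
      (50 + 1500 * ((m + 2) * (n + 1) * ((m + length (occs f cs m) + 3) * (2 * 4 ^ (\<alpha> - n)))))) ?Q"
        using init sizes \<alpha> big by (intro runs_search[OF occ]) auto
    qed (use init w in auto)
  qed (use init sizes in auto)
  then show ?thesis by (rule runs_conseq) simp_all
qed

lemma runs_solver_trivial:
  assumes "b > 0" "length w \<ge> 3" "w ! 0 = \<alpha>" "w ! 1 = n" "w ! 2 = m" "\<alpha> + n + m + 2 < wbound b"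
    and "\<alpha> \<le> n \<or> m < \<alpha>"
  shows "runs b solver (init_store w) 15 (\<lambda>s'. s' ''out'' 0 \<noteq> 0 \<longleftrightarrow> \<alpha> \<le> n)"
proof -
  let ?in = "\<lambda>i. Read ''in'' (Num i)" and ?s = "init_store w"
  have init: "?s ''in'' 0 = \<alpha>" "?s ''in'' 1 = n" "?s ''in'' (Suc 0) = n" "?s ''in'' 2 = m"
    using assms(2-5) by (auto simp: init_store_def)
  have sizes: "0 < wbound b" "1 < wbound b" "2 < wbound b" "\<alpha> < wbound b" "n < wbound b" "m < wbound b"
    using assms(6) by linarith+
  have "runs b solver ?s (nodes (Minus (?in 0) (?in 1)) + 1 + (nodes (Minus (?in 0) (?in 2)) + 1 + 3))
      (\<lambda>s'. s' ''out'' 0 \<noteq> 0 \<longleftrightarrow> \<alpha> \<le> n)"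
    unfolding solver_def
  proof (rule runs_If[OF assms(1)])
    assume "aval (Minus (?in 0) (?in 1)) ?s = 0"
    then show "runs b (''out'' ::= Num 1) ?s (nodes (Minus (?in 0) (?in 2)) + 1 + 3) (\<lambda>s'. s' ''out'' 0 \<noteq> 0 \<longleftrightarrow> \<alpha> \<le> n)"
      using init sizes assms(1) by (intro runs_wp) (auto simp: update_def)
  next
    assume "aval (Minus (?in 0) (?in 1)) ?s \<noteq> 0"
    then have "n < \<alpha>" "m < \<alpha>" using init assms(7) by auto
    then show "runs b (If (Minus (?in 0) (?in 2))
         (''out'' ::= Num 0)
         (parse ;; greedy ;; search)) ?s (nodes (Minus (?in 0) (?in 2)) + 1 + 3) (\<lambda>s'. s' ''out'' 0 \<noteq> 0 \<longleftrightarrow> \<alpha> \<le> n)"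
      using init sizes assms(1)
      by (intro runs_If) (auto simp: update_def intro!: runs_wp)
  qed (use init sizes in auto)
  then show ?thesis by (rule runs_conseq) simp_all
qed

text \<open>A deterministic run is a point mass, so the answer is certain and the expected time is
  the time of that run.\<close>

lemma runs_decides:
  assumes "runs b p (init_store w) T (\<lambda>s. s ''out'' 0 \<noteq> 0 \<longleftrightarrow> r)"
  shows "decides p w r" "expected_time p w \<le> of_nat (T * b)"
proof -
  obtain s t where st: "run p w = return_spmf (s, t)" "t \<le> T * b" "s ''out'' 0 \<noteq> 0 \<longleftrightarrow> r"
    using assms by (auto simp: runs_def run_def)
  show "decides p w r" using st(1,3) by (simp add: decides_def)
  show "expected_time p w \<le> of_nat (T * b)"
    using st(1,2) by (simp add: expected_time_def del: of_nat_mult)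
qed

section \<open>Size of the encoding and the final time bound\<close>

lemma length_enc_clause: "length (enc_clause f c) = 1 + 2 * length c"
proof -
  have "length (concat (map (enc_literal f) c)) = 2 * length c"
  proof (induction c)
    case (Cons l c)
    then show ?case by (cases l) auto
  qed simp
  then show ?thesis by (simp add: enc_clause_def)
qed

lemma set_enc_clause: "set (enc_clause f c) \<subseteq> {length c, 0, 1} \<union> f ` var ` set c"
proof -
  have "set (enc_literal f l) \<subseteq> {0, 1} \<union> {f (var l)}" for l by (cases l) auto
  then show ?thesis by (fastforce simp: enc_clause_def)
qed

text \<open>With \<open>l \<le> M ^ 2\<close> the dynamic program dominates, and the operation count
  is at most \<open>100000 * K * M ^ 4\<close>. The second factor, the bit length charged for each
  operation, is at most \<open>30 * M ^ 2\<close>.\<close>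

lemma time_bound:
  fixes m n l K M :: nat
  assumes "m + n \<le> M" "1 \<le> M" "l \<le> m * n" "1 \<le> K"
  shows "(12 + (200 * ((m + 1) * (n + 1)) + ((n + 1) * (400 * (l + 1)) +
      (50 + 1500 * ((m + 2) * (n + 1) * ((m + l + 3) * (2 * K))))))) * (2 * (m * n) + 6 * m + 2 * n + 20)
    \<le> 3000000 * (K * M ^ 6)"
proof -
  have mn: "m * n \<le> M * M" using assms(1) by (intro mult_le_mono) auto
  have MM: "M \<le> M * M" using assms(2) by simp
  have l: "l + 1 \<le> 2 * (M * M)" "m + l + 3 \<le> 5 * (M * M)"
    using mn MM assms by linarith+
  define X where "X = K * M ^ 4"
  have pow: "M ^ i \<le> X" if "i \<le> 4" for i
  proof -
    have "M ^ i \<le> M ^ 4" using assms(2) that by (intro power_increasing) auto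
    then show ?thesis unfolding X_def using assms(4) by (metis le_trans mult_le_mono1 nat_mult_1)
  qed
  have "(m + 1) * (n + 1) \<le> (2 * M) * (2 * M)"
    using assms by (intro mult_le_mono) auto
  also have "\<dots> = 4 * M ^ 2" by (simp add: power2_eq_square)
  finally have 1: "(m + 1) * (n + 1) \<le> 4 * X" using pow[of 2] by simp
  have "(n + 1) * (400 * (l + 1)) \<le> (2 * M) * (400 * (2 * (M * M)))"
    using assms l by (intro mult_le_mono) auto
  also have "\<dots> = 1600 * M ^ 3" by (simp add: power3_eq_cube)
  finally have 2: "(n + 1) * (400 * (l + 1)) \<le> 1600 * X" using pow[of 3] by simp
  have "(m + 2) * (n + 1) * ((m + l + 3) * (2 * K)) \<le> (3 * M) * (2 * M) * ((5 * (M * M)) * (2 * K))"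
    using assms l by (intro mult_le_mono) auto
  also have "\<dots> = 60 * X" by (simp add: X_def power4_eq_xxxx)
  finally have 3: "(m + 2) * (n + 1) * ((m + l + 3) * (2 * K)) \<le> 60 * X" .
  have "1 \<le> X" using pow[of 0] by simp
  then have "12 + (200 * ((m + 1) * (n + 1)) + ((n + 1) * (400 * (l + 1)) +
      (50 + 1500 * ((m + 2) * (n + 1) * ((m + l + 3) * (2 * K)))))) \<le> 100000 * X"
    using 1 2 3 by linarith
  moreover have "2 * (m * n) + 6 * m + 2 * n + 20 \<le> 30 * (M * M)"
    using mn MM assms(1,2) by linarith
  ultimately have "(12 + (200 * ((m + 1) * (n + 1)) + ((n + 1) * (400 * (l + 1)) +
      (50 + 1500 * ((m + 2) * (n + 1) * ((m + l + 3) * (2 * K))))))) * (2 * (m * n) + 6 * m + 2 * n + 20)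
    \<le> (100000 * X) * (30 * (M * M))" by (rule mult_le_mono)
  also have "\<dots> = 3000000 * (K * M ^ 6)" using power_add[of M 4 2] by (simp add: X_def power2_eq_square)
  finally show ?thesis .
qed

lemma less_wbound: "b < wbound b"
  by (simp add: wbound_def)

lemma solver_correct:
  fixes F :: "nat formula"
  assumes special: "transformed_special_instance F \<alpha>" and enc: "encodes w F \<alpha>"
  shows "\<exists>T. runs (snd T) solver (init_store w) (fst T) (\<lambda>s. s ''out'' 0 \<noteq> 0 \<longleftrightarrow> \<alpha> \<le> sat F) \<and>
    fst T * snd T \<le> 3000000 * (4 ^ (\<alpha> - card (vars F)) * max 1 (size F + card (vars F)) ^ 6)"
proof -
  define n m where "n = card (vars F)" and "m = size F"
  define k where "k = \<alpha> - n"
  define M where "M = max 1 (m + n)"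
  obtain f cs where f: "bij_betw f (vars F) {..<n}" and dist: "\<forall>c\<in>set cs. distinct c"
    and F: "mset (map set cs) = F" and w: "w = \<alpha> # n # m # concat (map (enc_clause f) cs)"
    using enc unfolding encodes_def n_def m_def by blast
  have len: "length cs = m" using F unfolding m_def by (metis length_map size_mset)
  interpret special_instance F \<alpha> f cs m n
  proof
    show "distinct (cs ! i)" if "i < m" for i using that len dist by simp
  qed (use special f F n_def m_def in auto)
  show ?thesis
  proof (cases "\<alpha> \<le> n \<or> m < \<alpha>")
    case True
    \<comment> \<open>Since \<open>b < 2 ^ b\<close>, it suffices that \<open>b\<close> exceeds all
      values met. Even with \<alpha> itself as a summand this is affordable, because
      \<open>\<alpha> \<le> k + n\<close> and \<open>k + 1 \<le> 4 ^ k\<close>.\<close>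
    define b where "b = \<alpha> + n + m + 3"
    have "runs b solver (init_store w) 15 (\<lambda>s. s ''out'' 0 \<noteq> 0 \<longleftrightarrow> \<alpha> \<le> n)"
      using True less_wbound[of b] by (intro runs_solver_trivial[of _ _ \<alpha> n m]) (auto simp: w b_def)
    \<comment> \<open>\<open>sat_iff_opt\<close> at 0 says that n clauses can always be
      satisfied.\<close>
    moreover have "\<alpha> \<le> n \<longleftrightarrow> \<alpha> \<le> sat F"
      using True sat_iff_opt[of 0] sat_le_size[of F] m_def by auto
    moreover have "15 * b \<le> 3000000 * (4 ^ k * M ^ 6)"
    proof -
      have "\<alpha> \<le> k + n" "m + n \<le> M" "1 \<le> M" by (auto simp: k_def M_def)
      then have "b \<le> k + 5 * M" unfolding b_def by linarith
      also have "\<dots> \<le> k * M + 5 * M" using \<open>1 \<le> M\<close> by simp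
      also have "\<dots> \<le> 5 * ((k + 1) * M)" by (simp add: algebra_simps)
      also have "\<dots> \<le> 5 * (4 ^ k * M ^ 6)"
      proof (intro mult_le_mono2 mult_le_mono)
        show "k + 1 \<le> 4 ^ k" by (induction k) auto
        show "M \<le> M ^ 6" using \<open>1 \<le> M\<close> self_le_power[of M 6] by simp
      qed
      finally show ?thesis by linarith
    qed
    ultimately show ?thesis
      unfolding k_def M_def n_def[symmetric] m_def[symmetric]
      by (intro exI[of _ "(15, b)"]) simp
  next
    case False
    then have \<alpha>: "n < \<alpha>" "\<alpha> \<le> m" by auto
    \<comment> \<open>Exceeds the tape length plus the slack demanded by \<open>tape\<close>, every
      tape entry, and \<open>m + 1\<close>. The last makes \<open>2 ^ (m + 1)\<close>, and with it
      every code of the table, smaller than \<open>2 ^ b\<close>.\<close>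
    define b where "b = 2 * (m * n) + 6 * m + 2 * n + 20"
    have bB: "b < wbound b" by (rule less_wbound)
    have "length (concat (map (enc_clause f) cs)) \<le> m * (2 * n + 1)"
    proof -
      have "\<forall>c \<in> set cs. length (enc_clause f c) \<le> 2 * n + 1"
        using length_clause len by (auto simp: length_enc_clause in_set_conv_nth)
      then have "sum_list (map (\<lambda>c. length (enc_clause f c)) cs) \<le> sum_list (map (\<lambda>c. 2 * n + 1) cs)"
        by (intro sum_list_mono) auto
      then show ?thesis using len by (simp add: length_concat o_def sum_list_triv)
    qed
    then have len_w: "length w + m + n + 10 < b" by (simp add: w b_def algebra_simps)
    have entry: "x < b" if x: "x \<in> set w" for x
    proof -
      consider "x \<in> {\<alpha>, n, m}" | c where "c \<in> set cs" "x \<in> set (enc_clause f c)"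
        using x by (auto simp: w)
      then show ?thesis
      proof cases
        case (2 c)
        then obtain i where i: "i < m" "c = cs ! i" using len by (auto simp: in_set_conv_nth)
        have "x \<in> {length c, 0, 1} \<union> f ` var ` set c" using set_enc_clause 2(2) by blast
        then have "x \<le> n + 1"
          using length_clause[OF i(1)] f_less var_in_vars[OF i(1)] i(2) by fastforce
        then show ?thesis by (simp add: b_def)
      qed (use \<alpha> in \<open>auto simp: b_def\<close>)
    qed
    interpret tape b m n w f cs
    proof
      show "length w + m + n + 10 < wbound b" using len_w bB by linarith
      show "\<forall>x\<in>set w. x < wbound b" using entry bB less_trans by blast
    qed (use len length_clause in \<open>auto simp: w\<close>)
    let ?l = "length (occs f cs m)"
    let ?T = "12 + (200 * ((m + 1) * (n + 1)) + ((n + 1) * (400 * (?l + 1)) +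
      (50 + 1500 * ((m + 2) * (n + 1) * ((m + ?l + 3) * (2 * 4 ^ (\<alpha> - n)))))))"
    have "runs b solver (init_store w) ?T
      (\<lambda>s. s ''out'' 0 \<noteq> 0 \<longleftrightarrow> \<alpha> - n \<le> opt (clauses_of R) {..<n} {..<m})"
    proof (rule runs_solver)
      show "occurrences b m n R" using bB by (intro occurrences) (simp add: b_def)
      show "2 ^ (m + 1) < wbound b"
        unfolding wbound_def by (intro power_strict_increasing) (auto simp: b_def)
    qed (use \<alpha> in \<open>auto simp: w\<close>)
    moreover have "\<alpha> - n \<le> opt (clauses_of R) {..<n} {..<m} \<longleftrightarrow> \<alpha> \<le> sat F"
      using sat_iff_opt[of "\<alpha> - n"] \<alpha> by simp
    moreover have "?T * b \<le> 3000000 * (4 ^ k * M ^ 6)"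
      unfolding b_def k_def
      by (rule time_bound) (use length_occs[of m cs n f] length_clause in \<open>auto simp: M_def\<close>)
    ultimately show ?thesis
      unfolding k_def M_def n_def[symmetric] m_def[symmetric]
      by (intro exI[of _ "(?T, b)"]) simp
  qed
qed

theorem theorem8:
  shows "\<exists>(p :: com) (A :: real) (C :: real) (d :: nat).
    \<forall>(F :: nat formula) (\<alpha> :: nat) (w :: nat list).
      transformed_special_instance F \<alpha> \<longrightarrow> encodes w F \<alpha> \<longrightarrow>
        decides p w (sat F \<ge> \<alpha>) \<and>
        (let k = real_of_int (max 0 (int \<alpha> - int (\<nu> F)));
             n = card (vars F);
             m = size F
         in expected_time p w
              \<le> ennreal (A * 8 powr (k + C * sqrt k) * real (max 1 (m + n)) ^ d))"
\<comment> \<open>\<open>A = 3000000\<close> and \<open>d = 6\<close> come from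
  \<open>time_bound\<close>; \<open>C = 0\<close> is possible because
  \<open>4 ^ (\<alpha> - n)\<close> is at most \<open>8 powr k\<close>.\<close>
proof (rule exI[of _ solver], rule exI[of _ 3000000], rule exI[of _ 0], rule exI[of _ 6],
    intro allI impI conjI)
  fix F :: "nat formula" and \<alpha> :: nat and w :: "nat list"
  assume special: "transformed_special_instance F \<alpha>" and enc: "encodes w F \<alpha>"
  let ?n = "card (vars F)"
  define M where "M = max 1 (size F + ?n)"
  define k where "k = real_of_int (max 0 (int \<alpha> - int (\<nu> F)))"
  obtain T b where run: "runs b solver (init_store w) T (\<lambda>s. s ''out'' 0 \<noteq> 0 \<longleftrightarrow> \<alpha> \<le> sat F)"
    and T: "T * b \<le> 3000000 * (4 ^ (\<alpha> - ?n) * M ^ 6)"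
    using solver_correct[OF special enc] unfolding M_def by auto
  show "decides solver w (\<alpha> \<le> sat F)" by (rule runs_decides[OF run])
  have "\<nu> F \<le> ?n"
    using special by (intro nu_le_card_vars) (simp add: transformed_special_instance_def)
  \<comment> \<open>The left side is truncated at 0 just as \<open>k\<close> is clamped there, so
    this also covers \<open>\<alpha> < n\<close>.\<close>
  then have k: "real (\<alpha> - ?n) \<le> k" by (simp add: k_def)
  have "(4::real) ^ (\<alpha> - ?n) \<le> 8 ^ (\<alpha> - ?n)" by (intro power_mono) auto
  also have "\<dots> = 8 powr real (\<alpha> - ?n)" by (simp add: powr_realpow)
  also have "\<dots> \<le> 8 powr k" using k by (intro powr_mono) auto
  finally have pow: "(4::real) ^ (\<alpha> - ?n) \<le> 8 powr k" .
  have "real (T * b) \<le> real (3000000 * (4 ^ (\<alpha> - ?n) * M ^ 6))" using T by (simp only: of_nat_le_iff)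
  also have "\<dots> = 3000000 * (4 ^ (\<alpha> - ?n) * real M ^ 6)" by simp
  also have "\<dots> \<le> 3000000 * (8 powr k * real M ^ 6)"
    using pow by (intro mult_left_mono mult_right_mono) auto
  finally have "real (T * b) \<le> 3000000 * 8 powr (k + 0 * sqrt k) * real M ^ 6" by simp
  then have "ennreal (real (T * b)) \<le> ennreal (3000000 * 8 powr (k + 0 * sqrt k) * real M ^ 6)"
    by (rule ennreal_leI)
  moreover have "expected_time solver w \<le> ennreal (real (T * b))"
    using runs_decides(2)[OF run] by (simp only: ennreal_of_nat_eq_real_of_nat)
  ultimately show "let k = real_of_int (max 0 (int \<alpha> - int (\<nu> F))); n = card (vars F); m = size F
      in expected_time solver w \<le> ennreal (3000000 * 8 powr (k + 0 * sqrt k) * real (max 1 (m + n)) ^ 6)"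
    unfolding Let_def k_def M_def by (rule order_trans[rotated])
qed

end
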